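(* Let $\Omega\subset X$ be a $\nu$-measurable set with $0<\nu(\Omega)<\nu(X)$. Then $\Omega$ is $m$-calibrable if, and only if, there exists an antisymmetric ($(\nu\otimes m_x)$-measurable) function $\mathbf g$ in $\Omega\times\Omega$ such that $$-1\le\mathbf g(x,y)\le1\qquad\text{for } (\nu\otimes m_x)\text{-a.e. } (x,y)\in\Omega\times\Omega,$$ and $$\lambda_\Omega^m=-\int_\Omega\mathbf g(x,y)\,dm_x(y)+1-m_x(\Omega)\qquad\text{for } \nu\text{-a.e. } x\in\Omega.$$
   Context: Metric random walk space: $(X,d)$ is a Polish metric space with its Borel $\sigma$-algebra and $m=(m_x)_{x\in X}$ is a family of Borel probability measures on $X$ such that $x\mapsto m_x(A)$ is Borel for every Borel set $A$, and each $m_x$ has finite first moment ($\int_X d(z,y)\,dm_x(y)<\infty$ for some, hence every, $z\in X$). $\nu$ is a $\sigma$-finite Radon measure on $X$ that is invariant, $\nu(A)=\int_X m_x(A)\,d\nu(x)$, and reversible for $m$: for every Borel $C\subset X\times X$, $\int_X\int_X\chi_C(x,y)\,dm_x(y)d\nu(x)=\int_X\int_X\chi_C(x,y)\,dm_y(x)d\nu(y)$. Put $L_m(A,B)=\int_A\int_B dm_x(y)d\nu(x)$; the space is assumed $m$-connected: $L_m(A,B)>0$ for any $\nu$-measurable sets $A,B$ of positive $\nu$-measure with $A\cup B=X$. $P_m(E)=L_m(E,X\setminus E)=\int_E\int_{X\setminus E}dm_x(y)d\nu(x)$ and $\lambda_\Omega^m:=\frac{P_m(\Omega)}{\nu(\Omega)}$.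 The $m$-Cheeger constant of $\Omega$ is $h_1^m(\Omega)=\inf\left\{\frac{P_m(E)}{\nu(E)}: E\subset\Omega \ \nu\text{-measurable},\ \nu(E)>0\right\}$; $\Omega$ is $m$-calibrable if $h_1^m(\Omega)=\lambda_\Omega^m$. $\nu\otimes m_x$ is the measure on $X\times X$ given by $(\nu\otimes m_x)(U)=\int_X\int_X\chi_U(x,y)\,dm_x(y)d\nu(x)$. Antisymmetric: $\mathbf g(x,y)=-\mathbf g(y,x)$ for $(\nu\otimes m_x)$-a.e. $(x,y)$. *)

theory Defs
  imports "HOL-Probability.Probability"
begin

text \<open>
  Borel sets are \<^term>\<open>sets borel\<close>; \<open>\<nu>\<close>-measurable sets are the members of
  \<^term>\<open>sets (completion \<nu>)\<close>.  By invariance of \<open>\<nu>\<close>, a \<open>\<nu>\<close>-measurable set is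
  \<open>m\<^sub>x\<close>-measurable, i.e. a member of \<^term>\<open>sets (completion (m x))\<close>, for \<open>\<nu>\<close>-almost every \<open>x\<close>
  (but not necessarily for all \<open>x\<close>); this is why the completions of the \<open>m\<^sub>x\<close> are used when
  \<open>m\<^sub>x\<close> is applied to such a set.
\<close>

text \<open>
  Schwartz's definition of a Radon measure; under the inner regularity below, local finiteness is
  the same as finiteness on compact sets, since the space is metric.
\<close>

definition radon_measure :: "'a::metric_space measure \<Rightarrow> bool" where
  "radon_measure \<nu> \<longleftrightarrow>
     sets \<nu> = sets borel \<and>
     (\<forall>x. \<exists>U. open U \<and> x \<in> U \<and> emeasure \<nu> U < \<infinity>) \<and>
     (\<forall>A\<in>sets borel. emeasure \<nu> A = (SUP K\<in>{K. K \<subseteq> A \<and> compact K}. emeasure \<nu> K))"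

definition mrw_L :: "('a::metric_space \<Rightarrow> 'a measure) \<Rightarrow> 'a measure \<Rightarrow> 'a set \<Rightarrow> 'a set \<Rightarrow> ennreal" where
  "mrw_L m \<nu> A B = (\<integral>\<^sup>+x\<in>A. emeasure (completion (m x)) B \<partial>completion \<nu>)"

text \<open>
  The class \<^class>\<open>polish_space\<close> is that of complete separable metric spaces.  The assumption
  \<open>kernel\<close> says that every \<open>m\<^sub>x\<close> is a Borel probability measure and that \<open>x \<mapsto> m\<^sub>x(A)\<close> is Borel
  for every Borel set \<open>A\<close>.
\<close>

locale metric_random_walk_space =
  fixes m :: "'a::polish_space \<Rightarrow> 'a measure" and \<nu> :: "'a measure"
  assumes kernel: "m \<in> borel \<rightarrow>\<^sub>M prob_algebra borel"
    and first_moment: "\<And>x. \<exists>z. (\<integral>\<^sup>+y. ennreal (dist z y) \<partial>m x) < \<infinity>"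
    and sigma_finite: "sigma_finite_measure \<nu>"
    and radon: "radon_measure \<nu>"
    and invariant: "\<And>A. A \<in> sets borel \<Longrightarrow> emeasure \<nu> A = (\<integral>\<^sup>+x. emeasure (m x) A \<partial>\<nu>)"
    and reversible: "\<And>C :: ('a \<times> 'a) set. C \<in> sets borel \<Longrightarrow>
          (\<integral>\<^sup>+x. (\<integral>\<^sup>+y. indicator C (x, y) \<partial>m x) \<partial>\<nu>) =
          (\<integral>\<^sup>+y. (\<integral>\<^sup>+x. indicator C (x, y) \<partial>m y) \<partial>\<nu>)"
    and connected: "\<And>A B. A \<in> sets (completion \<nu>) \<Longrightarrow> B \<in> sets (completion \<nu>) \<Longrightarrow>
          emeasure (completion \<nu>) A > 0 \<Longrightarrow> emeasure (completion \<nu>) B > 0 \<Longrightarrow>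
          A \<union> B = UNIV \<Longrightarrow> mrw_L m \<nu> A B > 0"

definition mrw_perimeter :: "('a::metric_space \<Rightarrow> 'a measure) \<Rightarrow> 'a measure \<Rightarrow> 'a set \<Rightarrow> ennreal" where
  "mrw_perimeter m \<nu> E = mrw_L m \<nu> E (UNIV - E)"

definition mrw_ratio :: "('a::metric_space \<Rightarrow> 'a measure) \<Rightarrow> 'a measure \<Rightarrow> 'a set \<Rightarrow> ennreal" where
  "mrw_ratio m \<nu> E = mrw_perimeter m \<nu> E / emeasure (completion \<nu>) E"

definition mrw_cheeger :: "('a::metric_space \<Rightarrow> 'a measure) \<Rightarrow> 'a measure \<Rightarrow> 'a set \<Rightarrow> ennreal" where
  "mrw_cheeger m \<nu> \<Omega> =
     (INF E\<in>{E \<in> sets (completion \<nu>). E \<subseteq> \<Omega> \<and> emeasure (completion \<nu>) E > 0}. mrw_ratio m \<nu> E)"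

definition mrw_calibrable :: "('a::metric_space \<Rightarrow> 'a measure) \<Rightarrow> 'a measure \<Rightarrow> 'a set \<Rightarrow> bool" where
  "mrw_calibrable m \<nu> \<Omega> \<longleftrightarrow> mrw_cheeger m \<nu> \<Omega> = mrw_ratio m \<nu> \<Omega>"

text \<open>
  \<open>\<nu> \<otimes> m\<^sub>x\<close>.  The set function below is countably additive as soon as \<open>m\<close> is a Borel kernel and
  \<open>\<nu>\<close> a Borel measure, so that \<^const>\<open>measure_of\<close> does not fall back to the null measure.
\<close>

definition mrw_prod :: "('a::metric_space \<Rightarrow> 'a measure) \<Rightarrow> 'a measure \<Rightarrow> ('a \<times> 'a) measure" where
  "mrw_prod m \<nu> =
     measure_of UNIV (sets borel) (\<lambda>U. \<integral>\<^sup>+x. (\<integral>\<^sup>+y. indicator U (x, y) \<partial>m x) \<partial>\<nu>)"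

end

theory Submission
  imports Defs
begin

text \<open>
  The theorem is a continuous max-flow--min-cut statement.  Read an antisymmetric \<open>g\<close> with
  \<open>\<bar>g\<bar> \<le> 1\<close> as a flow on the pairs of points of \<open>\<Omega>\<close>, where \<open>\<nu> \<otimes> m\<^sub>x\<close> gives the capacity.  With
  \<open>f(x) = 1 - m\<^sub>x(\<Omega>) - \<lambda>\<close>, the equation of the theorem says that the net outflow
  \<open>\<integral>\<^sub>\<Omega> g(x,y) dm\<^sub>x(y)\<close> equals \<open>f(x)\<close>.  For \<open>E \<subseteq> \<Omega>\<close> the perimeter is the escape
  \<open>\<integral>\<^sub>E (1 - m\<^sub>x(\<Omega>)) d\<nu>\<close> out of \<open>\<Omega>\<close> plus the capacity \<open>L(E, \<Omega> - E)\<close> of the cut between \<open>E\<close> and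
  \<open>\<Omega> - E\<close>, so \<open>\<lambda> \<nu>(E) \<le> P(E)\<close> is the same as \<open>- \<integral>\<^sub>E f d\<nu> \<le> L(E, \<Omega> - E)\<close>.  Calibrability is this
  cut condition for all \<open>E\<close>; by the choice of \<open>\<lambda>\<close>, also \<open>\<integral>\<^sub>\<Omega> f d\<nu> = 0\<close>.

  If a flow with outflow \<open>f\<close> exists, the cut condition follows: by antisymmetry and reversibility
  the flow inside \<open>E \<times> E\<close> cancels, so that \<open>\<integral>\<^sub>E f\<close> is the flow through the cut, which is at least
  minus its capacity (\<open>flow_imp_cut_condition\<close>).

  Conversely (\<open>cut_condition_imp_flow\<close>), take a flow \<open>g\<close> that minimises \<open>\<integral> (f - outflow g)\<^sup>2\<close> and
  let \<open>u = f - outflow g\<close>, \<open>E = {u < 0}\<close>.  Changing \<open>g\<close> to \<open>- 1\<close> on \<open>E \<times> (\<Omega> - E)\<close>, and to \<open>1\<close> on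
  the mirror image, cannot improve the fit, which forces \<open>g = - 1\<close> on \<open>E \<times> (\<Omega> - E)\<close> already:
  the cut is saturated.  Hence \<open>\<integral>\<^sub>E u = \<integral>\<^sub>E f + L(E, \<Omega> - E) \<ge> 0\<close>, so \<open>E\<close> is a null set and
  \<open>u \<ge> 0\<close>.  As \<open>\<integral> u = \<integral> f - \<integral> outflow g = 0\<close>, it follows that \<open>u = 0\<close>.

  A minimiser exists although bounded sequences of flows need not have convergent subsequences
  (\<open>midpoint_quasiconvex_attains_Inf\<close>): among nearly optimal flows, choose those of nearly minimal \<open>L\<^sup>2\<close>
  norm; by the parallelogram law they form a Cauchy sequence.

  The remaining work replaces \<open>\<nu>\<close>-measurable sets and functions by Borel ones.
\<close>

section \<open>Minimising midpoint-quasiconvex functionals of bounded functions\<close>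

text \<open>
  Let \<open>C n\<close> be the set of those \<open>g\<close> whose value is within \<open>1 / (n + 1)\<close> of the infimum \<open>\<delta>\<close>.  These
  sets are nested and closed under midpoints.  If \<open>g n \<in> C n\<close> has nearly minimal \<open>L\<^sup>2\<close> norm in
  \<open>C n\<close>, then the norms increase to a finite limit, so the parallelogram law makes the sequence
  Cauchy in \<open>L\<^sup>2\<close>; a subsequence converges almost everywhere, and its limit attains \<open>\<delta>\<close>.
  The limit is set to \<open>0\<close> where the subsequence diverges, so that pointwise symmetries of the
  members of \<open>G\<close> can survive without exceptional null sets.
\<close>

lemma (in finite_measure) midpoint_quasiconvex_attains_Inf:
  fixes J :: "('a \<Rightarrow> real) \<Rightarrow> real"
  assumes G_ne: "G \<noteq> {}"
    and G_meas: "\<And>g. g \<in> G \<Longrightarrow> g \<in> borel_measurable M"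
    and G_bound: "\<And>g x. g \<in> G \<Longrightarrow> \<bar>g x\<bar> \<le> 1"
    and G_mid: "\<And>g h. g \<in> G \<Longrightarrow> h \<in> G \<Longrightarrow> (\<lambda>x. (g x + h x) / 2) \<in> G"
    and G_lim: "\<And>g :: nat \<Rightarrow> 'a \<Rightarrow> real. (\<And>n. g n \<in> G) \<Longrightarrow>
          (\<lambda>x. if convergent (\<lambda>n. g n x) then lim (\<lambda>n. g n x) else 0) \<in> G"
    and J_nonneg: "\<And>g. g \<in> G \<Longrightarrow> 0 \<le> J g"
    and J_mid: "\<And>g h. g \<in> G \<Longrightarrow> h \<in> G \<Longrightarrow> J (\<lambda>x. (g x + h x) / 2) \<le> max (J g) (J h)"
    and J_cont: "\<And>(g :: nat \<Rightarrow> 'a \<Rightarrow> real) h. (\<And>n. g n \<in> G) \<Longrightarrow> h \<in> G \<Longrightarrow>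
          (AE x in M. (\<lambda>n. g n x) \<longlonglongrightarrow> h x) \<Longrightarrow> (\<lambda>n. J (g n)) \<longlonglongrightarrow> J h"
  shows "\<exists>g\<in>G. \<forall>h\<in>G. J g \<le> J h"
proof -
  define \<delta> where "\<delta> = Inf (J ` G)"
  define C where "C n = {g\<in>G. J g \<le> \<delta> + 1 / real (Suc n)}" for n :: nat
  define Q where "Q g = (\<integral>x. (g x)\<^sup>2 \<partial>M)" for g :: "'a \<Rightarrow> real"
  define r where "r n = Inf (Q ` C n)" for n
  have J_bdd: "bdd_below (J ` G)"
    using J_nonneg by (auto intro!: bdd_belowI[of _ 0])
  have \<delta>_le: "\<delta> \<le> J g" if "g \<in> G" for g
    unfolding \<delta>_def using that J_bdd by (auto intro: cInf_lower)
  have C_ne: "C n \<noteq> {}" for n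
  proof -
    have "Inf (J ` G) < \<delta> + 1 / real (Suc n)" by (simp add: \<delta>_def)
    then obtain g where "g \<in> G" "J g < \<delta> + 1 / real (Suc n)"
      using G_ne by (auto dest!: cInf_lessD[rotated])
    then show ?thesis by (auto simp: C_def)
  qed
  have C_G: "g \<in> G" if "g \<in> C n" for g n using that by (simp add: C_def)
  have C_mono: "C n \<subseteq> C k" if "k \<le> n" for k n
  proof
    fix g assume g: "g \<in> C n"
    have "1 / real (Suc n) \<le> 1 / real (Suc k)" using that by (simp add: frac_le)
    then show "g \<in> C k" using g by (auto simp: C_def)
  qed
  have int: "integrable M (\<lambda>x. g x * h x)" if "g \<in> G" "h \<in> G" for g h
  proof (rule integrable_const_bound[where B=1])
    show "AE x in M. norm (g x * h x) \<le> 1"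
      using G_bound that by (intro AE_I2) (simp add: abs_mult mult_le_one)
    show "(\<lambda>x. g x * h x) \<in> borel_measurable M" using that G_meas by measurable
  qed
  have Q_bound: "0 \<le> Q g" "Q g \<le> measure M (space M)" if "g \<in> G" for g
  proof -
    show "0 \<le> Q g" by (simp add: Q_def)
    have "Q g \<le> (\<integral>x. 1 \<partial>M)" unfolding Q_def
      using int[OF that that] G_bound[OF that]
      by (intro integral_mono) (auto simp: power2_eq_square abs_square_le_1[unfolded power2_eq_square])
    then show "Q g \<le> measure M (space M)" by simp
  qed
  have Q_bdd: "bdd_below (Q ` C n)" for n
    using Q_bound C_G by (auto intro!: bdd_belowI[of _ 0])
  have r_le: "r n \<le> Q g" if "g \<in> C n" for g n
    unfolding r_def using that Q_bdd by (auto intro: cInf_lower)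
  have r_mono: "r k \<le> r n" if "k \<le> n" for k n
    unfolding r_def using C_mono[OF that] C_ne Q_bdd by (intro cInf_superset_mono) auto
  have "\<exists>g\<in>C n. Q g < r n + 1 / real (Suc n)" for n
  proof -
    have "Inf (Q ` C n) < r n + 1 / real (Suc n)" by (simp add: r_def)
    then show ?thesis
      using C_ne by (auto dest!: cInf_lessD[rotated])
  qed
  then obtain g where gC: "\<And>n. g n \<in> C n" and gQ: "\<And>n. Q (g n) < r n + 1 / real (Suc n)"
    by metis
  have gG: "g n \<in> G" for n using gC C_G by blast
  note [measurable] = G_meas[OF gG]
  have r_bound: "r n \<le> measure M (space M)" for n
    using r_le[OF gC] Q_bound[OF gG] order_trans by blast
  obtain R where R: "r \<longlonglongrightarrow> R" and rR: "\<And>n. r n \<le> R"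
    using incseq_convergent[of r "measure M (space M)"] r_bound r_mono by (auto simp: incseq_def)
  \<comment> \<open>The parallelogram law in \<open>L\<^sup>2\<close>: the midpoint of \<open>g i\<close> and \<open>g j\<close> lies in \<open>C n\<close>, so that its norm
     is at least \<open>r n\<close>.\<close>
  have parallelogram: "(\<integral>x. (g i x - g j x)\<^sup>2 \<partial>M) \<le> 4 * (R - r n) + 4 / real (Suc n)"
    if "n \<le> i" "n \<le> j" for i j n
  proof -
    have "g i \<in> C n" "g j \<in> C n" using C_mono gC that by blast+
    then have "(\<lambda>x. (g i x + g j x) / 2) \<in> C n"
      using J_mid[of "g i" "g j"] G_mid[of "g i" "g j"] by (auto simp: C_def)
    then have "r n \<le> Q (\<lambda>x. (g i x + g j x) / 2)" by (rule r_le)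
    also have "\<dots> = (\<integral>x. (g i x * g i x + 2 * (g i x * g j x) + g j x * g j x) / 4 \<partial>M)"
      unfolding Q_def by (intro Bochner_Integration.integral_cong) (auto simp: power2_eq_square field_simps)
    also have "\<dots> = (Q (g i) + 2 * (\<integral>x. g i x * g j x \<partial>M) + Q (g j)) / 4"
      unfolding Q_def power2_eq_square using int gG by simp
    finally have 1: "4 * r n \<le> Q (g i) + 2 * (\<integral>x. g i x * g j x \<partial>M) + Q (g j)" by simp
    have "(\<integral>x. (g i x - g j x)\<^sup>2 \<partial>M) = (\<integral>x. g i x * g i x - 2 * (g i x * g j x) + g j x * g j x \<partial>M)"
      by (intro Bochner_Integration.integral_cong) (auto simp: power2_eq_square field_simps)
    also have "\<dots> = Q (g i) - 2 * (\<integral>x. g i x * g j x \<partial>M) + Q (g j)"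
      unfolding Q_def power2_eq_square using int gG by simp
    finally have 2: "(\<integral>x. (g i x - g j x)\<^sup>2 \<partial>M) \<le> 2 * Q (g i) + 2 * Q (g j) - 4 * r n"
      using 1 by simp
    have "Q (g l) \<le> R + 1 / real (Suc n)" if "n \<le> l" for l
    proof -
      have "1 / real (Suc l) \<le> 1 / real (Suc n)" using that by (simp add: frac_le)
      then show ?thesis using gQ[of l] rR[of l] by linarith
    qed
    from this[OF that(1)] this[OF that(2)] 2 show ?thesis by simp
  qed
  have d_int: "integrable M (\<lambda>x. (g i x - g j x)\<^sup>2)" for i j
    unfolding power2_eq_square using int[OF gG gG]
    by (simp add: algebra_simps)
  have g_int: "integrable M (g n)" for n
    by (rule integrable_const_bound[where B=1]) (use G_bound[OF gG] in auto)
  define K where "K = measure M (space M)"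
  have K0: "0 \<le> K" by (simp add: K_def)
  have cauchy: "\<exists>n. \<forall>i\<ge>n. \<forall>j\<ge>n. (\<integral>x. norm (g i x - g j x) \<partial>M) < e" if "e > 0" for e
  proof -
    \<comment> \<open>\<open>\<bar>t\<bar> \<le> t\<^sup>2 / c + c\<close> for \<open>c > 0\<close> bounds the \<open>L\<^sup>1\<close> norm by the \<open>L\<^sup>2\<close> norm.\<close>
    define c where "c = e / (2 * (K + 1))"
    have c: "c > 0" using that K0 by (simp add: c_def)
    have cK: "c * K < e / 2 "
      using that K0 by (simp add: c_def field_simps)
    have "(\<lambda>n. 4 * (R - r n) + 4 / real (Suc n)) \<longlonglongrightarrow> 4 * (R - R) + 0"
      by (intro tendsto_add tendsto_mult tendsto_diff tendsto_const R
          LIMSEQ_Suc[OF lim_const_over_n])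
    then have "(\<lambda>n. 4 * (R - r n) + 4 / real (Suc n)) \<longlonglongrightarrow> 0" by simp
    then have "\<forall>\<^sub>F n in sequentially. 4 * (R - r n) + 4 / real (Suc n) < c * e / 2"
      using c that by (intro order_tendstoD) auto
    then obtain n where n: "4 * (R - r n) + 4 / real (Suc n) < c * e / 2"
      by (auto simp: eventually_sequentially)
    have "(\<integral>x. norm (g i x - g j x) \<partial>M) < e" if "n \<le> i" "n \<le> j" for i j
    proof -
      have abs_le: "\<bar>t\<bar> \<le> t\<^sup>2 / c + c" for t :: real
      proof -
        have "0 \<le> (\<bar>t\<bar> - c)\<^sup>2" "0 \<le> \<bar>t\<bar> * c" using c by simp_all
        then have "\<bar>t\<bar> * c \<le> t\<^sup>2 + c * c" by (simp add: power2_diff power2_eq_square[of c])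
        then show ?thesis using c by (simp add: field_simps)
      qed
      have "(\<integral>x. norm (g i x - g j x) \<partial>M) \<le> (\<integral>x. (g i x - g j x)\<^sup>2 / c + c \<partial>M)"
        using abs_le g_int d_int by (intro integral_mono) auto
      also have "\<dots> = (\<integral>x. (g i x - g j x)\<^sup>2 \<partial>M) / c + c * K"
        using d_int by (simp add: K_def)
      also have "\<dots> < (c * e / 2) / c + e / 2"
        using parallelogram[OF that] n cK c
        by (intro add_strict_mono divide_strict_right_mono) auto
      also have "\<dots> = e" using c by simp
      finally show ?thesis .
    qed
    then show ?thesis by blast
  qed
  obtain s where s: "strict_mono s" and AEc: "AE x in M. Cauchy (\<lambda>i. g (s i) x)"
    using cauchy_L1_AE_cauchy_subseq[of M g] g_int cauchy by blast
  define h where "h = (\<lambda>x. if convergent (\<lambda>n. g (s n) x) then lim (\<lambda>n. g (s n) x) else 0)"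
  have hG: "h \<in> G" unfolding h_def using gG by (intro G_lim)
  have "AE x in M. (\<lambda>n. g (s n) x) \<longlonglongrightarrow> h x"
    using AEc
  proof eventually_elim
    case (elim x)
    then have "convergent (\<lambda>i. g (s i) x)" by (rule Cauchy_convergent)
    then show ?case unfolding h_def by (simp add: convergent_LIMSEQ_iff)
  qed
  from J_cont[OF gG hG this] have "(\<lambda>n. J (g (s n))) \<longlonglongrightarrow> J h" .
  moreover have "(\<lambda>n. \<delta> + 1 / real (Suc (s n))) \<longlonglongrightarrow> \<delta> + 0"
    using LIMSEQ_subseq_LIMSEQ[OF LIMSEQ_Suc[OF lim_const_over_n[of 1]] s]
    by (intro tendsto_add tendsto_const) (simp add: o_def)
  ultimately have "J h \<le> \<delta> + 0"
    by (rule LIMSEQ_le) (use gC in \<open>auto simp: C_def\<close>)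
  then show ?thesis using hG \<delta>_le by force
qed

section \<open>The semidirect product of a measure and a kernel\<close>

definition semidirect_product :: "'a measure \<Rightarrow> ('a \<Rightarrow> 'a measure) \<Rightarrow> ('a \<times> 'a) measure" where
  "semidirect_product N k = N \<bind> (\<lambda>x. distr (k x) (N \<Otimes>\<^sub>M N) (Pair x))"

lemma measurable_distr_Pair:
  assumes [measurable]: "k \<in> N \<rightarrow>\<^sub>M subprob_algebra N"
  shows "(\<lambda>x. distr (k x) (N \<Otimes>\<^sub>M N) (Pair x)) \<in> N \<rightarrow>\<^sub>M subprob_algebra (N \<Otimes>\<^sub>M N)"
  by (rule measurable_distr2[where M=N]) (auto simp: assms)

lemma measurable_Pair_kernel:
  assumes "k \<in> N \<rightarrow>\<^sub>M subprob_algebra N" "x \<in> space N"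
  shows "Pair x \<in> k x \<rightarrow>\<^sub>M N \<Otimes>\<^sub>M N"
  using measurable_Pair1'[OF assms(2)] sets_kernel[OF assms] by (simp cong: measurable_cong_sets)

lemma nn_integral_semidirect_product:
  assumes k: "k \<in> N \<rightarrow>\<^sub>M subprob_algebra N" and F: "F \<in> borel_measurable (N \<Otimes>\<^sub>M N)"
  shows "(\<integral>\<^sup>+z. F z \<partial>semidirect_product N k) = (\<integral>\<^sup>+x. \<integral>\<^sup>+y. F (x, y) \<partial>k x \<partial>N)"
  unfolding semidirect_product_def
  by (auto simp: nn_integral_bind[OF F measurable_distr_Pair[OF k]] nn_integral_distr F
      measurable_Pair_kernel[OF k] intro!: nn_integral_cong)

lemma sets_semidirect_product:
  assumes k: "k \<in> N \<rightarrow>\<^sub>M subprob_algebra N" and ne: "space N \<noteq> {}"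
  shows "sets (semidirect_product N k) = sets (N \<Otimes>\<^sub>M N)"
  unfolding semidirect_product_def by (rule sets_bind_measurable[OF measurable_distr_Pair[OF k] ne])

lemma AE_semidirect_product:
  assumes k: "k \<in> N \<rightarrow>\<^sub>M subprob_algebra N" and P: "Measurable.pred (N \<Otimes>\<^sub>M N) P"
  shows "(AE z in semidirect_product N k. P z) \<longleftrightarrow> (AE x in N. AE y in k x. P (x, y))"
  unfolding semidirect_product_def AE_bind[OF measurable_distr_Pair[OF k] P]
  by (intro AE_cong_simp[OF refl])
     (use P in \<open>simp add: AE_distr_iff measurable_Pair_kernel[OF k] simp_implies_def pred_def\<close>)

text \<open>
  The direction of \<open>AE_semidirect_product\<close> that holds for an arbitrary predicate: cover the
  exceptional set by a measurable null set.
\<close>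

lemma AE_semidirect_productD:
  assumes k: "k \<in> N \<rightarrow>\<^sub>M subprob_algebra N" and ne: "space N \<noteq> {}"
    and P: "AE z in semidirect_product N k. P z"
  shows "AE x in N. AE y in k x. P (x, y)"
proof -
  let ?M = "semidirect_product N k"
  obtain Z where Z: "Z \<in> null_sets ?M" "{z \<in> space ?M. \<not> P z} \<subseteq> Z"
    using P by (auto elim!: AE_E simp: null_sets_def)
  have sp: "space ?M = space (N \<Otimes>\<^sub>M N)"
    using sets_semidirect_product[OF k ne] by (rule sets_eq_imp_space_eq)
  have Z': "Z \<in> sets (N \<Otimes>\<^sub>M N)" using Z sets_semidirect_product[OF k ne] by auto
  have "AE z in ?M. z \<notin> Z" using Z(1) by (rule AE_not_in)
  then have "AE x in N. AE y in k x. (x, y) \<notin> Z"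
    using Z' by (subst (asm) AE_semidirect_product[OF k]) (auto simp: pred_def)
  then show ?thesis
  proof (rule AE_mp[OF _ AE_I2[OF impI]])
    fix x assume x: "x \<in> space N" and "AE y in k x. (x, y) \<notin> Z"
    from this(2) show "AE y in k x. P (x, y)"
    proof (rule AE_mp[OF _ AE_I2[OF impI]])
      fix y assume "y \<in> space (k x)" "(x, y) \<notin> Z"
      moreover have "space (k x) = space N" using sets_kernel[OF k x] by (rule sets_eq_imp_space_eq)
      ultimately have "(x, y) \<in> space ?M" using x by (simp add: sp space_pair_measure)
      then show "P (x, y)" using Z \<open>(x, y) \<notin> Z\<close> by auto
    qed
  qed
qed

lemma integral_semidirect_product:
  fixes F :: "'a \<times> 'a \<Rightarrow> real"
  assumes k: "k \<in> N \<rightarrow>\<^sub>M subprob_algebra N" and fin: "finite_measure N"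
    and F: "F \<in> borel_measurable (N \<Otimes>\<^sub>M N)" and b: "\<And>z. \<bar>F z\<bar> \<le> B"
  shows "(\<integral>z. F z \<partial>semidirect_product N k) = (\<integral>x. \<integral>y. F (x, y) \<partial>k x \<partial>N)"
proof -
  have "(\<integral>z. F z \<partial>semidirect_product N k) = (\<integral>x. \<integral>z. F z \<partial>distr (k x) (N \<Otimes>\<^sub>M N) (Pair x) \<partial>N)"
    unfolding semidirect_product_def
  proof (rule integral_bind[where K="N \<Otimes>\<^sub>M N" and B'=1 and B=B])
    show "AE x in N. emeasure (distr (k x) (N \<Otimes>\<^sub>M N) (Pair x))
        (space (distr (k x) (N \<Otimes>\<^sub>M N) (Pair x))) \<le> ennreal 1"
    proof (rule AE_I2)
      fix x assume x: "x \<in> space N"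
      interpret K: subprob_space "k x" using k x by (rule subprob_space_kernel)
      show "emeasure (distr (k x) (N \<Otimes>\<^sub>M N) (Pair x))
          (space (distr (k x) (N \<Otimes>\<^sub>M N) (Pair x))) \<le> ennreal 1"
        using K.subprob_emeasure_le_1
        by (simp add: emeasure_distr measurable_Pair_kernel[OF k x])
    qed
  qed (use F b fin measurable_distr_Pair[OF k] in auto)
  also have "\<dots> = (\<integral>x. \<integral>y. F (x, y) \<partial>k x \<partial>N)"
    by (intro Bochner_Integration.integral_cong refl integral_distr measurable_Pair_kernel[OF k] F)
  finally show ?thesis .
qed

lemma borel_measurable_integral_kernel:
  fixes F :: "'a \<times> 'a \<Rightarrow> real"
  assumes k: "k \<in> N \<rightarrow>\<^sub>M subprob_algebra N" and F: "F \<in> borel_measurable (N \<Otimes>\<^sub>M N)"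
  shows "(\<lambda>x. \<integral>y. F (x, y) \<partial>k x) \<in> borel_measurable N"
proof -
  have "(\<lambda>x. integral\<^sup>L (distr (k x) (N \<Otimes>\<^sub>M N) (Pair x)) F) \<in> borel_measurable N"
    by (rule measurable_compose[OF measurable_distr_Pair[OF k] integral_measurable_subprob_algebra[OF F]])
  also have "?this \<longleftrightarrow> ?thesis"
    by (intro measurable_cong integral_distr measurable_Pair_kernel[OF k] F)
  finally show ?thesis .
qed

section \<open>Flows of bounded density\<close>

text \<open>
  A continuous weighted graph: \<open>k x\<close> distributes the weight of the edges at the vertex \<open>x\<close>, and
  symmetry is reversibility of \<open>k\<close> with respect to \<open>N\<close>.  The kernel may lose mass, as a
  random walk does when it is restricted to a domain.
\<close>

locale symmetric_kernel = finite_measure N for N :: "'a measure" +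
  fixes k :: "'a \<Rightarrow> 'a measure"
  assumes nonempty: "space N \<noteq> {}"
    and kernel: "k \<in> N \<rightarrow>\<^sub>M subprob_algebra N"
    and symmetric: "\<And>C. C \<in> sets (N \<Otimes>\<^sub>M N) \<Longrightarrow>
          (\<integral>\<^sup>+x. \<integral>\<^sup>+y. indicator C (x, y) \<partial>k x \<partial>N) = (\<integral>\<^sup>+x. \<integral>\<^sup>+y. indicator C (y, x) \<partial>k x \<partial>N)"
begin

abbreviation edges :: "('a \<times> 'a) measure" where
  "edges \<equiv> semidirect_product N k"

abbreviation outflow :: "('a \<times> 'a \<Rightarrow> real) \<Rightarrow> 'a \<Rightarrow> real" where
  "outflow g x \<equiv> (\<integral>y. g (x, y) \<partial>k x)"

text \<open>
  Antisymmetry and the bound are required everywhere.  The pointwise limits used in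
  \<open>midpoint_quasiconvex_attains_Inf\<close> preserve this, and no null sets have to be tracked.
\<close>

definition flows :: "('a \<times> 'a \<Rightarrow> real) set" where
  "flows = {g \<in> borel_measurable (N \<Otimes>\<^sub>M N). (\<forall>x y. g (x, y) = - g (y, x)) \<and> (\<forall>z. \<bar>g z\<bar> \<le> 1)}"

lemma flowsD:
  assumes "g \<in> flows"
  shows "g \<in> borel_measurable (N \<Otimes>\<^sub>M N)" "g (x, y) = - g (y, x)" "\<bar>g z\<bar> \<le> 1"
  using assms unfolding flows_def by blast+

lemma sets_edges [simp, measurable_cong]: "sets edges = sets (N \<Otimes>\<^sub>M N)"
  by (rule sets_semidirect_product[OF kernel nonempty])

lemma space_edges: "space edges = space N \<times> space N"
  using sets_eq_imp_space_eq[OF sets_edges] by (simp add: space_pair_measure)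

lemma finite_measure_edges: "finite_measure edges"
proof
  have "emeasure edges (space edges) = (\<integral>\<^sup>+z. 1 \<partial>edges)" by simp
  also have "\<dots> = (\<integral>\<^sup>+x. \<integral>\<^sup>+y. 1 \<partial>k x \<partial>N)"
    by (subst nn_integral_semidirect_product[OF kernel]) auto
  also have "\<dots> \<le> (\<integral>\<^sup>+x. 1 \<partial>N)"
    by (intro nn_integral_mono)
       (simp add: subprob_space.subprob_emeasure_le_1[OF subprob_space_kernel[OF kernel]])
  also have "\<dots> < \<infinity>" by (simp add: less_top[symmetric])
  finally show "emeasure edges (space edges) \<noteq> \<infinity>" by simp
qed

sublocale edges: finite_measure edges by (rule finite_measure_edges)

lemma integrable_edges:
  fixes F :: "'a \<times> 'a \<Rightarrow> real"
  assumes "F \<in> borel_measurable (N \<Otimes>\<^sub>M N)" "\<And>z. \<bar>F z\<bar> \<le> B"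
  shows "integrable edges F"
  by (rule edges.integrable_const_bound[where B=B]) (use assms in auto)

lemma integral_edges_swap:
  fixes F :: "'a \<times> 'a \<Rightarrow> real"
  assumes F: "F \<in> borel_measurable (N \<Otimes>\<^sub>M N)"
  shows "(\<integral>(x, y). F (y, x) \<partial>edges) = (\<integral>z. F z \<partial>edges)"
proof -
  let ?s = "\<lambda>(x, y). (y, x)"
  have "distr edges (N \<Otimes>\<^sub>M N) ?s = edges"
  proof (rule measure_eqI)
    fix C assume "C \<in> sets (distr edges (N \<Otimes>\<^sub>M N) ?s)"
    then have C [measurable]: "C \<in> sets (N \<Otimes>\<^sub>M N)" by simp
    have "emeasure (distr edges (N \<Otimes>\<^sub>M N) ?s) C = (\<integral>\<^sup>+z. indicator C z \<partial>distr edges (N \<Otimes>\<^sub>M N) ?s)"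
      by simp
    also have "\<dots> = (\<integral>\<^sup>+z. indicator C (?s z) \<partial>edges)"
      by (intro nn_integral_distr) measurable
    also have "\<dots> = (\<integral>\<^sup>+x. \<integral>\<^sup>+y. indicator C (y, x) \<partial>k x \<partial>N)"
      by (subst nn_integral_semidirect_product[OF kernel]) auto
    also have "\<dots> = (\<integral>\<^sup>+x. \<integral>\<^sup>+y. indicator C (x, y) \<partial>k x \<partial>N)"
      using symmetric[OF C] by simp
    also have "\<dots> = emeasure edges C"
      by (subst nn_integral_semidirect_product[OF kernel, symmetric]) auto
    finally show "emeasure (distr edges (N \<Otimes>\<^sub>M N) ?s) C = emeasure edges C" .
  qed simp
  then have "(\<integral>z. F z \<partial>edges) = (\<integral>z. F z \<partial>distr edges (N \<Otimes>\<^sub>M N) ?s)" by simp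
  also have "\<dots> = (\<integral>z. F (?s z) \<partial>edges)"
    by (intro integral_distr F) measurable
  finally show ?thesis by (simp add: case_prod_unfold)
qed

lemma measurable_outflow:
  "g \<in> flows \<Longrightarrow> outflow g \<in> borel_measurable N"
  by (rule borel_measurable_integral_kernel[OF kernel flowsD(1)])

lemma integrable_kernel:
  fixes F :: "'a \<times> 'a \<Rightarrow> real"
  assumes F: "F \<in> borel_measurable (N \<Otimes>\<^sub>M N)" "\<And>z. \<bar>F z\<bar> \<le> B" and x: "x \<in> space N"
  shows "integrable (k x) (\<lambda>y. F (x, y))"
proof -
  interpret K: subprob_space "k x" using kernel x by (rule subprob_space_kernel)
  show ?thesis
    by (rule K.integrable_const_bound[where B=B])
       (use F measurable_compose[OF measurable_Pair_kernel[OF kernel x] F(1)] in auto)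
qed

lemma abs_outflow_le_1:
  assumes g: "g \<in> flows" and x: "x \<in> space N"
  shows "\<bar>outflow g x\<bar> \<le> 1"
proof -
  interpret K: subprob_space "k x" using kernel x by (rule subprob_space_kernel)
  have int: "integrable (k x) (\<lambda>y. g (x, y))"
    using flowsD[OF g] x by (intro integrable_kernel[where B=1])
  have "\<bar>outflow g x\<bar> \<le> (\<integral>y. \<bar>g (x, y)\<bar> \<partial>k x)" by (rule integral_abs_bound)
  also have "\<dots> \<le> (\<integral>y. 1 \<partial>k x)"
    using int flowsD(3)[OF g] by (intro integral_mono) auto
  also have "\<dots> \<le> 1" using K.subprob_measure_le_1 by simp
  finally show ?thesis .
qed

lemma integral_outflow_over:
  assumes g: "g \<in> flows" and h: "h \<in> borel_measurable N" "\<And>x. x \<in> space N \<Longrightarrow> \<bar>h x\<bar> \<le> B"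
  shows "(\<integral>x. h x * outflow g x \<partial>N) = (\<integral>(x, y). h x * g (x, y) \<partial>edges)"
proof -
  note [measurable] = flowsD(1)[OF g] h(1)
  define h' where "h' x = (if x \<in> space N then h x else 0)" for x
  have h' [measurable]: "h' \<in> borel_measurable N"
    using h(1) by (rule measurable_cong[THEN iffD1, rotated]) (simp add: h'_def)
  have B: "\<bar>h' x * g z\<bar> \<le> \<bar>B\<bar>" for x z
    using mult_mono[of "\<bar>h' x\<bar>" "\<bar>B\<bar>" "\<bar>g z\<bar>" 1] h(2)[of x] flowsD(3)[OF g, of z]
    by (auto simp: h'_def abs_mult)
  have "(\<integral>(x, y). h x * g (x, y) \<partial>edges) = (\<integral>(x, y). h' x * g (x, y) \<partial>edges)"
    by (intro Bochner_Integration.integral_cong) (auto simp: h'_def space_edges)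
  also have "\<dots> = (\<integral>x. \<integral>y. h' x * g (x, y) \<partial>k x \<partial>N)"
    using B by (subst integral_semidirect_product[OF kernel finite_measure_axioms, where B="\<bar>B\<bar>"]) auto
  also have "\<dots> = (\<integral>x. h x * outflow g x \<partial>N)"
    by (intro Bochner_Integration.integral_cong) (auto simp: h'_def)
  finally show ?thesis by simp
qed

lemma integral_outflow:
  assumes g: "g \<in> flows"
  shows "(\<integral>x. outflow g x \<partial>N) = 0"
proof -
  have "(\<integral>z. g z \<partial>edges) = (\<integral>(x, y). g (y, x) \<partial>edges)"
    by (rule integral_edges_swap[OF flowsD(1)[OF g], symmetric])
  also have "\<dots> = (\<integral>z. - g z \<partial>edges)"
  proof (intro Bochner_Integration.integral_cong refl)
    fix z show "(case z of (x, y) \<Rightarrow> g (y, x)) = - g z"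
      using flowsD(2)[OF g, of "snd z" "fst z"] by (simp add: case_prod_unfold)
  qed
  also have "\<dots> = - (\<integral>z. g z \<partial>edges)" by simp
  finally have "(\<integral>z. g z \<partial>edges) = 0" by linarith
  then show ?thesis using integral_outflow_over[OF g, of "\<lambda>_. 1" 1] by (simp add: case_prod_unfold)
qed

abbreviation cut :: "'a set \<Rightarrow> 'a \<times> 'a \<Rightarrow> real" where
  "cut E \<equiv> indicator (E \<times> (space N - E))"

text \<open>
  By antisymmetry and the symmetry of the edge measure, the flow within \<open>E \<times> E\<close> cancels; what
  leaves \<open>E\<close> in total is the flow through the cut.
\<close>

lemma integral_outflow_cut:
  assumes g: "g \<in> flows" and E: "E \<in> sets N"
  shows "(\<integral>x. indicator E x * outflow g x \<partial>N) = (\<integral>z. cut E z * g z \<partial>edges)"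
proof -
  note [measurable] = flowsD(1)[OF g] E
  have gB: "\<bar>indicator A z * g z\<bar> \<le> 1" for A z
    using flowsD(3)[OF g] by (auto simp: indicator_def)
  have "(\<integral>z. indicator (E \<times> E) z * g z \<partial>edges)
      = (\<integral>(x, y). indicator (E \<times> E) (y, x) * g (y, x) \<partial>edges)"
    by (rule integral_edges_swap[symmetric, where F="\<lambda>z. indicator (E \<times> E) z * g z"]) measurable
  also have "\<dots> = (\<integral>z. - (indicator (E \<times> E) z * g z) \<partial>edges)"
  proof (intro Bochner_Integration.integral_cong refl)
    fix z show "(case z of (x, y) \<Rightarrow> indicator (E \<times> E) (y, x) * g (y, x)) = - (indicator (E \<times> E) z * g z)"
      using flowsD(2)[OF g, of "fst z" "snd z"] by (cases z) (auto simp: indicator_def)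
  qed
  finally have 0: "(\<integral>z. indicator (E \<times> E) z * g z \<partial>edges) = 0" by simp
  have "(\<integral>x. indicator E x * outflow g x \<partial>N) = (\<integral>(x, y). indicator E x * g (x, y) \<partial>edges)"
    by (rule integral_outflow_over[OF g, where B=1]) auto
  also have "\<dots> = (\<integral>z. indicator (E \<times> E) z * g z + cut E z * g z \<partial>edges)"
    by (intro Bochner_Integration.integral_cong) (auto simp: space_edges indicator_def)
  also have "\<dots> = (\<integral>z. cut E z * g z \<partial>edges)"
    using gB 0 by (subst Bochner_Integration.integral_add) (auto intro!: integrable_edges[where B=1])
  finally show ?thesis .
qed

lemma integral_cut:
  assumes [measurable]: "E \<in> sets N"
  shows "(\<integral>z. cut E z \<partial>edges) = (\<integral>x. indicator E x * measure (k x) (space N - E) \<partial>N)"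
proof -
  have "(\<integral>z. cut E z \<partial>edges) = (\<integral>x. \<integral>y. cut E (x, y) \<partial>k x \<partial>N)"
    by (rule integral_semidirect_product[OF kernel finite_measure_axioms, where B=1]) auto
  also have "\<dots> = (\<integral>x. indicator E x * measure (k x) (space N - E) \<partial>N)"
  proof (intro Bochner_Integration.integral_cong refl)
    fix x assume x: "x \<in> space N"
    have "space (k x) = space N" using sets_kernel[OF kernel x] by (rule sets_eq_imp_space_eq)
    then have "(space N - E) \<inter> space (k x) = space N - E" by auto
    then show "(\<integral>y. cut E (x, y) \<partial>k x) = indicator E x * measure (k x) (space N - E)"
      by (simp add: indicator_times)
  qed
  finally show ?thesis .
qed

lemma flow_imp_cut_condition:
  assumes g: "g \<in> flows" and E: "E \<in> sets N"
  shows "- (\<integral>x. indicator E x * outflow g x \<partial>N) \<le> (\<integral>x. indicator E x * measure (k x) (space N - E) \<partial>N)"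
proof -
  note [measurable] = flowsD(1)[OF g] E
  have "- (\<integral>z. cut E z * g z \<partial>edges) = (\<integral>z. - (cut E z * g z) \<partial>edges)" by simp
  also have "\<dots> \<le> (\<integral>z. cut E z \<partial>edges)"
  proof (rule integral_mono)
    show "integrable edges (\<lambda>z. - (cut E z * g z))"
      using flowsD(3)[OF g] by (intro integrable_edges[where B=1]) (auto simp: indicator_def)
    show "integrable edges (cut E)" by (intro integrable_edges[where B=1]) auto
    show "- (cut E z * g z) \<le> cut E z" for z
      using flowsD(3)[OF g, of z] by (auto simp: indicator_def)
  qed
  finally show ?thesis unfolding integral_outflow_cut[OF g E] integral_cut[OF E] .
qed

text \<open>
  The squared defect is convex in the flow and continuous along almost everywhere convergent
  sequences of flows, since all outflows are bounded by \<open>1\<close>.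
\<close>

lemma flow_least_squares:
  assumes f [measurable]: "f \<in> borel_measurable N" and fB: "\<And>x. x \<in> space N \<Longrightarrow> \<bar>f x\<bar> \<le> B"
  shows "\<exists>g\<in>flows. \<forall>h\<in>flows. (\<integral>x. (f x - outflow g x)\<^sup>2 \<partial>N) \<le> (\<integral>x. (f x - outflow h x)\<^sup>2 \<partial>N)"
proof (rule edges.midpoint_quasiconvex_attains_Inf)
  have sq: "(f x - outflow g x)\<^sup>2 \<le> (\<bar>B\<bar> + 1)\<^sup>2" if "g \<in> flows" "x \<in> space N" for g x
  proof -
    have "\<bar>f x - outflow g x\<bar> \<le> \<bar>B\<bar> + 1"
      using fB[OF that(2)] abs_outflow_le_1[OF that] by linarith
    then show ?thesis by (simp add: abs_le_square_iff[symmetric])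
  qed
  have int: "integrable N (\<lambda>x. (f x - outflow g x)\<^sup>2)" if "g \<in> flows" for g
    using measurable_outflow[OF that] sq[OF that]
    by (intro integrable_const_bound[where B="(\<bar>B\<bar> + 1)\<^sup>2"]) auto
  show "flows \<noteq> {}"
    by (auto simp: flows_def intro!: exI[of _ "\<lambda>_. 0"])
  show "g \<in> borel_measurable edges" if "g \<in> flows" for g
    using flowsD(1)[OF that] by simp
  show "\<bar>g z\<bar> \<le> 1" if "g \<in> flows" for g z using that by (rule flowsD)
  show "0 \<le> (\<integral>x. (f x - outflow g x)\<^sup>2 \<partial>N)" for g by simp
  show "(\<lambda>z. (g z + h z) / 2) \<in> flows" if "g \<in> flows" "h \<in> flows" for g h
    unfolding flows_def
  proof (intro CollectI conjI allI)
    show "(\<lambda>z. (g z + h z) / 2) \<in> borel_measurable (N \<Otimes>\<^sub>M N)"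
      using flowsD(1) that by (intro borel_measurable_divide borel_measurable_add) auto
    show "(g (x, y) + h (x, y)) / 2 = - ((g (y, x) + h (y, x)) / 2)" for x y
    proof -
      have "g (x, y) + h (x, y) = - (g (y, x) + h (y, x))"
        using flowsD(2)[OF that(1), of x y] flowsD(2)[OF that(2), of x y] by simp
      then show ?thesis by (simp only: minus_divide_left)
    qed
    show "\<bar>(g z + h z) / 2\<bar> \<le> 1" for z
    proof -
      have "\<bar>g z + h z\<bar> \<le> 2"
        using flowsD(3)[OF that(1), of z] flowsD(3)[OF that(2), of z] by linarith
      then show ?thesis by simp
    qed
  qed
  show "(\<integral>x. (f x - outflow (\<lambda>z. (g z + h z) / 2) x)\<^sup>2 \<partial>N)
      \<le> max (\<integral>x. (f x - outflow g x)\<^sup>2 \<partial>N) (\<integral>x. (f x - outflow h x)\<^sup>2 \<partial>N)"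
    if "g \<in> flows" "h \<in> flows" for g h
  proof -
    have "(\<integral>x. (f x - outflow (\<lambda>z. (g z + h z) / 2) x)\<^sup>2 \<partial>N)
        = (\<integral>x. (f x - (outflow g x + outflow h x) / 2)\<^sup>2 \<partial>N)"
    proof (intro Bochner_Integration.integral_cong refl)
      fix x assume "x \<in> space N"
      then have "integrable (k x) (\<lambda>y. g (x, y))" "integrable (k x) (\<lambda>y. h (x, y))"
        using flowsD that by (auto intro!: integrable_kernel[where B=1])
      then show "(f x - outflow (\<lambda>z. (g z + h z) / 2) x)\<^sup>2 = (f x - (outflow g x + outflow h x) / 2)\<^sup>2"
        by simp
    qed
    also have "\<dots> \<le> (\<integral>x. ((f x - outflow g x)\<^sup>2 + (f x - outflow h x)\<^sup>2) / 2 \<partial>N)"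
    proof (rule integral_mono')
      show "integrable N (\<lambda>x. ((f x - outflow g x)\<^sup>2 + (f x - outflow h x)\<^sup>2) / 2)"
        using int that by simp
      have "(c - (a + b) / 2)\<^sup>2 \<le> ((c - a)\<^sup>2 + (c - b)\<^sup>2) / 2" for a b c :: real
        using zero_le_power2[of "a - b"] by (simp add: power2_eq_square field_simps)
      then show "(f x - (outflow g x + outflow h x) / 2)\<^sup>2
          \<le> ((f x - outflow g x)\<^sup>2 + (f x - outflow h x)\<^sup>2) / 2" for x .
    qed auto
    also have "\<dots> = ((\<integral>x. (f x - outflow g x)\<^sup>2 \<partial>N) + (\<integral>x. (f x - outflow h x)\<^sup>2 \<partial>N)) / 2"
      using int that by simp
    also have "(a + b) / 2 \<le> max a b" for a b :: real by (simp add: max_def)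
    finally show ?thesis .
  qed
  show "(\<lambda>z. if convergent (\<lambda>n. g n z) then lim (\<lambda>n. g n z) else 0) \<in> flows" (is "?h \<in> _")
    if g: "\<And>n. g n \<in> flows" for g :: "nat \<Rightarrow> 'a \<times> 'a \<Rightarrow> real"
    unfolding flows_def
  proof (intro CollectI conjI allI)
    note [measurable] = flowsD(1)[OF g]
    have "Measurable.pred (N \<Otimes>\<^sub>M N) (\<lambda>z. convergent (\<lambda>n. g n z))"
      unfolding Cauchy_convergent_iff[symmetric] pred_def by (rule sets_Collect_Cauchy) measurable
    then show "?h \<in> borel_measurable (N \<Otimes>\<^sub>M N)" by measurable
    show "?h (x, y) = - ?h (y, x)" for x y
    proof -
      have eq: "(\<lambda>n. g n (x, y)) = (\<lambda>n. - g n (y, x))" using flowsD(2)[OF g] by blast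
      show ?thesis
      proof (cases "convergent (\<lambda>n. g n (y, x))")
        case True
        then have "(\<lambda>n. - g n (y, x)) \<longlonglongrightarrow> - lim (\<lambda>n. g n (y, x))"
          by (intro tendsto_minus) (simp add: convergent_LIMSEQ_iff)
        then show ?thesis using True by (auto simp: eq limI convergent_def)
      next
        case False
        then show ?thesis by (simp add: eq convergent_minus_iff[symmetric])
      qed
    qed
    show "\<bar>?h z\<bar> \<le> 1" for z
    proof (cases "convergent (\<lambda>n. g n z)")
      case True
      then have "(\<lambda>n. \<bar>g n z\<bar>) \<longlonglongrightarrow> \<bar>?h z\<bar>"
        by (intro tendsto_rabs) (simp add: convergent_LIMSEQ_iff)
      then show ?thesis by (rule LIMSEQ_le_const2) (use flowsD(3)[OF g] in auto)
    qed simp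
  qed
  show "(\<lambda>n. \<integral>x. (f x - outflow (g n) x)\<^sup>2 \<partial>N) \<longlonglongrightarrow> (\<integral>x. (f x - outflow h x)\<^sup>2 \<partial>N)"
    if g: "\<And>n. g n \<in> flows" and h: "h \<in> flows" and lim: "AE z in edges. (\<lambda>n. g n z) \<longlonglongrightarrow> h z"
    for g :: "nat \<Rightarrow> 'a \<times> 'a \<Rightarrow> real" and h
  proof (rule integral_dominated_convergence[where w="\<lambda>_. (\<bar>B\<bar> + 1)\<^sup>2"])
    note [measurable] = measurable_outflow[OF g] measurable_outflow[OF h]
    show "(\<lambda>x. (f x - outflow h x)\<^sup>2) \<in> borel_measurable N"
      "(\<lambda>x. (f x - outflow (g n) x)\<^sup>2) \<in> borel_measurable N" for n
      by measurable
    show "integrable N (\<lambda>_. (\<bar>B\<bar> + 1)\<^sup>2)" by simp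
    show "AE x in N. norm ((f x - outflow (g n) x)\<^sup>2) \<le> (\<bar>B\<bar> + 1)\<^sup>2" for n
      using sq[OF g] by (intro AE_I2) simp
    have "AE x in N. AE y in k x. (\<lambda>n. g n (x, y)) \<longlonglongrightarrow> h (x, y)"
      by (rule AE_semidirect_productD[OF kernel nonempty lim])
    then show "AE x in N. (\<lambda>n. (f x - outflow (g n) x)\<^sup>2) \<longlonglongrightarrow> (f x - outflow h x)\<^sup>2"
    proof (rule AE_mp[OF _ AE_I2[OF impI]])
      fix x assume x: "x \<in> space N" and ae: "AE y in k x. (\<lambda>n. g n (x, y)) \<longlonglongrightarrow> h (x, y)"
      interpret K: subprob_space "k x" using kernel x by (rule subprob_space_kernel)
      note m = measurable_compose[OF measurable_Pair_kernel[OF kernel x] flowsD(1)]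
      have "(\<lambda>n. outflow (g n) x) \<longlonglongrightarrow> outflow h x"
        by (rule integral_dominated_convergence[where w="\<lambda>_. 1"])
           (use m[OF g] m[OF h] ae flowsD(3)[OF g] in auto)
      then show "(\<lambda>n. (f x - outflow (g n) x)\<^sup>2) \<longlonglongrightarrow> (f x - outflow h x)\<^sup>2"
        by (intro tendsto_power tendsto_diff tendsto_const)
    qed
  qed
qed

text \<open>
  The first-order condition at a minimiser: on the segment from \<open>g\<close> to \<open>h\<close> the squared defect is
  \<open>\<integral> u\<^sup>2 - 2 t \<integral> u w + t\<^sup>2 \<integral> w\<^sup>2\<close> with \<open>w = outflow h - outflow g\<close>, which would drop below \<open>\<integral> u\<^sup>2\<close> for
  small \<open>t\<close> if \<open>\<integral> u w\<close> were positive.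
\<close>

lemma flow_least_squares_variation:
  assumes f [measurable]: "f \<in> borel_measurable N" and fB: "\<And>x. x \<in> space N \<Longrightarrow> \<bar>f x\<bar> \<le> B"
    and g: "g \<in> flows" and h: "h \<in> flows"
    and min: "\<And>h. h \<in> flows \<Longrightarrow>
      (\<integral>x. (f x - outflow g x)\<^sup>2 \<partial>N) \<le> (\<integral>x. (f x - outflow h x)\<^sup>2 \<partial>N)"
  shows "(\<integral>x. (f x - outflow g x) * (outflow h x - outflow g x) \<partial>N) \<le> 0"
proof (rule ccontr)
  define u where "u x = f x - outflow g x" for x
  define w where "w x = outflow h x - outflow g x" for x
  have [measurable]: "u \<in> borel_measurable N" "w \<in> borel_measurable N"
    unfolding u_def w_def using measurable_outflow[OF g] measurable_outflow[OF h] by auto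
  have uB: "\<bar>u x\<bar> \<le> \<bar>B\<bar> + 1" and wB: "\<bar>w x\<bar> \<le> 2" if "x \<in> space N" for x
    using fB[OF that] abs_outflow_le_1[OF g that] abs_outflow_le_1[OF h that]
    unfolding u_def w_def by linarith+
  have prod: "integrable N (\<lambda>x. p x * q x)"
    if "p \<in> borel_measurable N" "q \<in> borel_measurable N"
      "\<And>x. x \<in> space N \<Longrightarrow> \<bar>p x\<bar> \<le> P" "\<And>x. x \<in> space N \<Longrightarrow> \<bar>q x\<bar> \<le> R" for p q P and R :: real
  proof (rule integrable_const_bound[where B="P * R"])
    show "AE x in N. norm (p x * q x) \<le> P * R"
    proof (rule AE_I2)
      fix x assume x: "x \<in> space N"
      have "\<bar>p x\<bar> * \<bar>q x\<bar> \<le> P * R"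
        using that(3)[OF x] that(4)[OF x] by (intro mult_mono) (auto intro: order_trans[OF abs_ge_zero])
      then show "norm (p x * q x) \<le> P * R" by (simp add: abs_mult)
    qed
  qed (use that in measurable)
  have int [simp]: "integrable N (\<lambda>x. u x * u x)" "integrable N (\<lambda>x. u x * w x)"
      "integrable N (\<lambda>x. w x * w x)"
    using uB wB by (auto intro!: prod)
  define I where "I = (\<integral>x. u x * w x \<partial>N)"
  define K where "K = (\<integral>x. w x * w x \<partial>N)"
  assume "\<not> ?thesis"
  then have I: "I > 0" by (simp add: I_def u_def w_def)
  have K: "K \<ge> 0" by (simp add: K_def)
  \<comment> \<open>a step this short gives \<open>t * K < I\<close> while staying on the segment\<close>
  define t where "t = min 1 (I / (K + 1))"
  have t: "0 < t" "t \<le> 1" "t \<le> I / (K + 1)"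
    using I K by (auto simp: t_def)
  let ?h = "\<lambda>z. (1 - t) * g z + t * h z"
  have "?h \<in> flows"
    unfolding flows_def
  proof (intro CollectI conjI allI)
    show "?h \<in> borel_measurable (N \<Otimes>\<^sub>M N)"
      using flowsD(1)[OF g] flowsD(1)[OF h] by measurable
    show "?h (x, y) = - ?h (y, x)" for x y
      using flowsD(2)[OF g, of x y] flowsD(2)[OF h, of x y] by (simp add: algebra_simps)
    show "\<bar>?h z\<bar> \<le> 1" for z
      using convex_bound_le[of "\<bar>g z\<bar>" 1 "\<bar>h z\<bar>" "1 - t" t] flowsD(3)[OF g, of z] flowsD(3)[OF h, of z] t
        abs_triangle_ineq[of "(1 - t) * g z" "t * h z"]
      by (simp add: abs_mult)
  qed
  from min[OF this] have "(\<integral>x. (u x)\<^sup>2 \<partial>N) \<le> (\<integral>x. (f x - outflow ?h x)\<^sup>2 \<partial>N)"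
    by (simp add: u_def)
  also have "\<dots> = (\<integral>x. u x * u x - (2 * t) * (u x * w x) + t\<^sup>2 * (w x * w x) \<partial>N)"
  proof (intro Bochner_Integration.integral_cong refl)
    fix x assume "x \<in> space N"
    then have "integrable (k x) (\<lambda>y. g (x, y))" "integrable (k x) (\<lambda>y. h (x, y))"
      using flowsD g h by (auto intro!: integrable_kernel[where B=1])
    then have "outflow ?h x = (1 - t) * outflow g x + t * outflow h x" by simp
    also have "f x - \<dots> = u x - t * w x" by (simp add: u_def w_def algebra_simps)
    finally show "(f x - outflow ?h x)\<^sup>2 = u x * u x - (2 * t) * (u x * w x) + t\<^sup>2 * (w x * w x)"
      by (simp only: power2_eq_square) (simp add: algebra_simps)
  qed
  also have "\<dots> = (\<integral>x. (u x)\<^sup>2 \<partial>N) - 2 * t * I + t\<^sup>2 * K"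
    by (simp add: I_def K_def power2_eq_square)
  finally have "2 * t * I \<le> t\<^sup>2 * K" by simp
  then have "t * (2 * I) \<le> t * (t * K)" by (simp add: power2_eq_square algebra_simps)
  then have "2 * I \<le> t * K" using t by (simp add: mult_le_cancel_left)
  also have "\<dots> \<le> I / (K + 1) * K" using t K by (intro mult_right_mono)
  also have "\<dots> \<le> I" using I K by (simp add: field_simps)
  finally show False using I by simp
qed

text \<open>
  A least-squares flow saturates the cut around the set where its outflow is too large; the cut
  condition then makes this set null.
\<close>

theorem cut_condition_imp_flow:
  assumes f [measurable]: "f \<in> borel_measurable N" and fB: "\<And>x. x \<in> space N \<Longrightarrow> \<bar>f x\<bar> \<le> B"
    and total: "(\<integral>x. f x \<partial>N) = 0"
    and cut: "\<And>E. E \<in> sets N \<Longrightarrow>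
      - (\<integral>x. indicator E x * f x \<partial>N) \<le> (\<integral>x. indicator E x * measure (k x) (space N - E) \<partial>N)"
  shows "\<exists>g\<in>flows. AE x in N. f x = outflow g x"
proof -
  obtain g where g: "g \<in> flows" and min: "\<And>h. h \<in> flows \<Longrightarrow>
      (\<integral>x. (f x - outflow g x)\<^sup>2 \<partial>N) \<le> (\<integral>x. (f x - outflow h x)\<^sup>2 \<partial>N)"
    using flow_least_squares[OF f fB] by blast
  note g_meas [measurable] = flowsD(1)[OF g]
  define u where "u x = f x - outflow g x" for x
  have u_meas [measurable]: "u \<in> borel_measurable N"
    unfolding u_def using measurable_outflow[OF g] by auto
  have uB: "\<bar>u x\<bar> \<le> \<bar>B\<bar> + 1" if "x \<in> space N" for x
    using fB[OF that] abs_outflow_le_1[OF g that] unfolding u_def by linarith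
  have f_int: "integrable N f" 
    using fB by (intro integrable_const_bound[where B=B]) auto
  have div_int: "integrable N (outflow g)"
    using abs_outflow_le_1[OF g] measurable_outflow[OF g]
    by (intro integrable_const_bound[where B=1]) auto
  have u_int: "integrable N u"
    unfolding u_def using f_int div_int by simp
  define E where "E = {x \<in> space N. u x < 0}"
  have E [measurable]: "E \<in> sets N" unfolding E_def by measurable
  \<comment> \<open>Points of \<open>E\<close> send out too much, so let \<open>h\<close> send as much as possible across the cut into \<open>E\<close>.\<close>
  define h where "h z = g z + indicator (E \<times> (space N - E)) z * (- 1 - g z)
      + indicator ((space N - E) \<times> E) z * (1 - g z)" for z
  have h: "h \<in> flows"
    unfolding flows_def
  proof (intro CollectI conjI allI)
    show "h \<in> borel_measurable (N \<Otimes>\<^sub>M N)" unfolding h_def by measurable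
    show "h (x, y) = - h (y, x)" for x y
      using flowsD(2)[OF g, of x y] by (auto simp: h_def indicator_def)
    show "\<bar>h z\<bar> \<le> 1" for z
      using flowsD(3)[OF g, of z] by (auto simp: h_def indicator_def)
  qed
  note h_meas [measurable] = flowsD(1)[OF h]
  have sub_int: "integrable edges (\<lambda>(x, y). u x * q (x, y))" if q: "q \<in> flows" for q
  proof (rule edges.integrable_const_bound[where B="\<bar>B\<bar> + 1"])
    show "AE z in edges. norm (case z of (x, y) \<Rightarrow> u x * q (x, y)) \<le> \<bar>B\<bar> + 1"
    proof (rule AE_I2)
      fix z assume "z \<in> space edges"
      then have "\<bar>u (fst z)\<bar> * \<bar>q z\<bar> \<le> (\<bar>B\<bar> + 1) * 1"
        using uB flowsD(3)[OF q] by (intro mult_mono) (auto simp: space_edges)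
      then show "norm (case z of (x, y) \<Rightarrow> u x * q (x, y)) \<le> \<bar>B\<bar> + 1"
        by (simp add: case_prod_unfold abs_mult)
    qed
    show "(\<lambda>(x, y). u x * q (x, y)) \<in> borel_measurable edges"
      using flowsD(1)[OF q] by measurable
  qed
  \<comment> \<open>\<open>v z = u x * (h z - g z)\<close> is nonnegative by the choice of \<open>h\<close>, and its integral is at most \<open>0\<close> by minimality.\<close>
  define v where "v = (\<lambda>(x, y). u x * h (x, y) - u x * g (x, y))"
  have v_int: "integrable edges v"
    using Bochner_Integration.integrable_diff[OF sub_int[OF h] sub_int[OF g]]
    by (simp add: v_def case_prod_unfold)
  have v_nonneg: "0 \<le> v z" if "z \<in> space edges" for z
  proof (cases z)
    case (Pair x y)
    then have "x \<in> space N" "y \<in> space N" using that by (auto simp: space_edges)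
    moreover have "v z = u x * (h z - g z)" by (simp add: v_def Pair algebra_simps)
    ultimately show ?thesis
      using flowsD(3)[OF g, of z] Pair
      by (auto simp: h_def E_def indicator_def zero_le_mult_iff)
  qed
  have "(\<integral>z. v z \<partial>edges) = (\<integral>x. u x * outflow h x \<partial>N) - (\<integral>x. u x * outflow g x \<partial>N)"
    using Bochner_Integration.integral_diff[OF sub_int[OF h] sub_int[OF g]]
      integral_outflow_over[OF h u_meas uB] integral_outflow_over[OF g u_meas uB]
    by (simp add: v_def case_prod_unfold)
  also have "\<dots> = (\<integral>x. u x * outflow h x - u x * outflow g x \<partial>N)"
  proof (rule Bochner_Integration.integral_diff[symmetric])
    have "integrable N (\<lambda>x. u x * outflow q x)" if q: "q \<in> flows" for q
    proof (rule Bochner_Integration.integrable_bound[OF u_int])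
      show "(\<lambda>x. u x * outflow q x) \<in> borel_measurable N"
        using measurable_outflow[OF q] by measurable
      show "AE x in N. norm (u x * outflow q x) \<le> norm (u x)"
        using abs_outflow_le_1[OF q] by (intro AE_I2) (simp add: abs_mult mult_left_le)
    qed
    then show "integrable N (\<lambda>x. u x * outflow h x)" "integrable N (\<lambda>x. u x * outflow g x)"
      using g h by auto
  qed
  also have "\<dots> \<le> 0"
    using flow_least_squares_variation[OF f fB g h min] by (simp add: u_def algebra_simps)
  finally have "(\<integral>z. v z \<partial>edges) \<le> 0" .
  moreover have "0 \<le> (\<integral>z. v z \<partial>edges)"
    using v_nonneg by (intro integral_nonneg_AE AE_I2)
  ultimately have "(\<integral>z. v z \<partial>edges) = 0" by (rule antisym)
  then have "AE z in edges. v z = 0"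
    using integral_nonneg_eq_0_iff_AE[OF v_int AE_I2[OF v_nonneg]] by simp
  then have "AE z in edges. cut E z * g z = - cut E z"
  proof (rule AE_mp[OF _ AE_I2[OF impI]])
    fix z assume z: "z \<in> space edges" "v z = 0"
    show "cut E z * g z = - cut E z"
    proof (cases "z \<in> E \<times> (space N - E)")
      case True
      then obtain x y where xy: "z = (x, y)" "x \<in> E" "y \<in> space N" "y \<notin> E" by auto
      then have "u x < 0" "u x * (- 1 - g z) = 0"
        using z(2) by (auto simp: v_def h_def E_def algebra_simps)
      then show ?thesis using True by simp
    qed simp
  qed
  then have "(\<integral>z. cut E z * g z \<partial>edges) = (\<integral>z. - cut E z \<partial>edges)"
    by (intro integral_cong_AE) auto
  then have flow_E: "(\<integral>x. indicator E x * outflow g x \<partial>N)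
      = - (\<integral>x. indicator E x * measure (k x) (space N - E) \<partial>N)"
    using integral_outflow_cut[OF g E] integral_cut[OF E] by simp
  have ind_int: "integrable N (\<lambda>x. indicator E x * q x)" if "integrable N q" for q :: "'a \<Rightarrow> real"
    using integrable_mult_indicator[OF E that] by simp
  have "(\<integral>x. indicator E x * u x \<partial>N)
      = (\<integral>x. indicator E x * f x \<partial>N) - (\<integral>x. indicator E x * outflow g x \<partial>N)"
    unfolding u_def right_diff_distrib
    by (rule Bochner_Integration.integral_diff[OF ind_int[OF f_int] ind_int[OF div_int]])
  then have "0 \<le> (\<integral>x. indicator E x * u x \<partial>N)"
    using cut[OF E] flow_E by simp
  then have "(\<integral>x. - (indicator E x * u x) \<partial>N) \<le> 0" by simp
  moreover have neg: "0 \<le> - (indicator E x * u x)" for x by (auto simp: E_def indicator_def)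
  ultimately have "(\<integral>x. - (indicator E x * u x) \<partial>N) = 0"
    by (intro antisym integral_nonneg_AE AE_I2)
  then have "AE x in N. - (indicator E x * u x) = 0"
    using integral_nonneg_eq_0_iff_AE[of N "\<lambda>x. - (indicator E x * u x)"] neg ind_int[OF u_int] by simp
  then have u_nonneg: "AE x in N. 0 \<le> u x"
    by (rule AE_mp) (auto intro!: AE_I2 simp: E_def indicator_def split: if_splits)
  have "(\<integral>x. u x \<partial>N) = 0"
    unfolding u_def using total integral_outflow[OF g] f_int div_int by simp
  then have "AE x in N. u x = 0"
    using integral_nonneg_eq_0_iff_AE[OF u_int u_nonneg] by simp
  then show ?thesis using g by (intro bexI[of _ g]) (auto simp: u_def)
qed

end

section \<open>Completions\<close>

lemma completion_AE_eq:
  assumes A: "A \<in> sets M" and ae: "AE x in M. x \<in> A \<longleftrightarrow> x \<in> B" and B: "B \<subseteq> space M"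
  shows "B \<in> sets (completion M)" and "emeasure (completion M) B = emeasure M A"
proof -
  have ae': "AE x in completion M. x \<in> A \<longleftrightarrow> x \<in> B" using ae by (rule AE_completion)
  show B': "B \<in> sets (completion M)" using completion.in_sets_AE[OF ae'] A B by simp
  have "emeasure (completion M) A = emeasure (completion M) B"
    using ae' A B' by (intro emeasure_eq_AE) auto
  then show "emeasure (completion M) B = emeasure M A" using A by simp
qed

lemma integral_completion_AE_eq:
  fixes f h :: "'a \<Rightarrow> real"
  assumes f: "f \<in> borel_measurable M" and ae: "AE x in M. f x = h x"
  shows "(\<integral>x. h x \<partial>completion M) = (\<integral>x. f x \<partial>M)"
proof -
  have ae': "AE x in completion M. f x = h x" using ae by (rule AE_completion)
  have "h \<in> borel_measurable (completion M)"
  proof (rule measurableI)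
    fix S :: "real set" assume S: "S \<in> sets borel"
    have "AE x in completion M. x \<in> f -` S \<inter> space M \<longleftrightarrow> x \<in> h -` S \<inter> space M"
      using ae' by eventually_elim auto
    then show "h -` S \<inter> space (completion M) \<in> sets (completion M)"
      using completion.in_sets_AE measurable_sets[OF f S] by (metis Int_lower2 sets_completionI_sets space_completion)
  qed simp
  then have "(\<integral>x. h x \<partial>completion M) = (\<integral>x. f x \<partial>completion M)"
    using ae' measurable_completion[OF f] by (intro integral_cong_AE) auto
  also have "\<dots> = (\<integral>x. f x \<partial>M)" by (rule integral_completion[OF f])
  finally show ?thesis .
qed

lemma sets_borel_prod:
  "sets (borel \<Otimes>\<^sub>M borel) = sets (borel :: ('a::second_countable_topology \<times> 'b::second_countable_topology) measure)"
  by (simp only: borel_prod)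

section \<open>The edge measure of a reversible random walk\<close>

context metric_random_walk_space
begin

lemma sets_invariant [simp, measurable_cong]: "sets \<nu> = sets borel"
  using radon by (simp add: radon_measure_def)

lemma space_invariant [simp]: "space \<nu> = UNIV"
  using sets_eq_imp_space_eq[OF sets_invariant] by simp

lemma sets_pair_invariant: "sets (\<nu> \<Otimes>\<^sub>M \<nu>) = sets (borel :: ('a \<times> 'a) measure)"
  by (simp add: sets_borel_prod)

lemma subprob_kernel: "m \<in> \<nu> \<rightarrow>\<^sub>M subprob_algebra \<nu>"
proof -
  have "subprob_algebra \<nu> = subprob_algebra borel" by (rule subprob_algebra_cong) simp
  then show ?thesis
    using measurable_prob_algebraD[OF kernel] by (simp cong: measurable_cong_sets)
qed

lemma prob_space_walk: "prob_space (m x)"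
  and sets_walk [simp, measurable_cong]: "sets (m x) = sets borel"
  using measurable_space[OF kernel, of x] by (simp_all add: space_prob_algebra)

lemma space_walk [simp]: "space (m x) = UNIV"
  using sets_eq_imp_space_eq[OF sets_walk] by simp

text \<open>
  \<^const>\<open>measure_of\<close> keeps the given set function only if that is a measure; here this holds because
  the set function is the semidirect product of \<open>\<nu>\<close> and \<open>m\<close>.
\<close>

lemma mrw_prod_eq: "mrw_prod m \<nu> = semidirect_product \<nu> m"
proof -
  let ?S = "semidirect_product \<nu> m"
  have sets: "sets ?S = sets borel"
    using sets_semidirect_product[OF subprob_kernel] by (simp add: sets_borel_prod)
  have "mrw_prod m \<nu> = measure_of UNIV (sets borel) (emeasure ?S)"
    unfolding mrw_prod_def
  proof (rule measure_of_eq)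
    fix U :: "('a \<times> 'a) set" assume "U \<in> sigma_sets UNIV (sets borel)"
    then have U: "U \<in> sets borel" using sets.sigma_sets_eq[of "borel :: ('a \<times> 'a) measure"] by simp
    have "emeasure ?S U = (\<integral>\<^sup>+z. indicator U z \<partial>?S)" using U by (simp add: sets)
    also have "\<dots> = (\<integral>\<^sup>+x. \<integral>\<^sup>+y. indicator U (x, y) \<partial>m x \<partial>\<nu>)"
      using U by (intro nn_integral_semidirect_product[OF subprob_kernel] borel_measurable_indicator)
        (simp add: sets_borel_prod)
    finally show "(\<integral>\<^sup>+x. \<integral>\<^sup>+y. indicator U (x, y) \<partial>m x \<partial>\<nu>) = emeasure ?S U" by simp
  qed simp
  also have "\<dots> = measure_of (space ?S) (sets ?S) (emeasure ?S)"
    using sets_eq_imp_space_eq[OF sets] by (simp add: sets)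
  finally show ?thesis by (simp add: measure_of_of_measure)
qed

lemma sets_mrw_prod [simp, measurable_cong]: "sets (mrw_prod m \<nu>) = sets borel"
  using sets_semidirect_product[OF subprob_kernel] by (simp add: mrw_prod_eq sets_borel_prod)

lemma space_mrw_prod [simp]: "space (mrw_prod m \<nu>) = UNIV"
  using sets_eq_imp_space_eq[OF sets_mrw_prod] by simp

lemma emeasure_mrw_prod:
  assumes U: "U \<in> sets borel"
  shows "emeasure (mrw_prod m \<nu>) U = (\<integral>\<^sup>+x. \<integral>\<^sup>+y. indicator U (x, y) \<partial>m x \<partial>\<nu>)"
proof -
  have "emeasure (mrw_prod m \<nu>) U = (\<integral>\<^sup>+z. indicator U z \<partial>mrw_prod m \<nu>)" using U by simp
  also have "\<dots> = (\<integral>\<^sup>+x. \<integral>\<^sup>+y. indicator U (x, y) \<partial>m x \<partial>\<nu>)"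
    unfolding mrw_prod_eq using U
    by (intro nn_integral_semidirect_product[OF subprob_kernel] borel_measurable_indicator)
      (simp add: sets_borel_prod)
  finally show ?thesis .
qed

lemma AE_mrw_prodD:
  "AE z in mrw_prod m \<nu>. P z \<Longrightarrow> AE x in \<nu>. AE y in m x. P (x, y)"
  unfolding mrw_prod_eq by (rule AE_semidirect_productD[OF subprob_kernel]) simp_all

lemma AE_mrw_prod_swap:
  assumes "AE z in mrw_prod m \<nu>. P z"
  shows "AE (x, y) in mrw_prod m \<nu>. P (y, x)"
proof -
  obtain Z where Z: "{z. \<not> P z} \<subseteq> Z" "Z \<in> sets borel" "emeasure (mrw_prod m \<nu>) Z = 0"
    using assms by (auto elim!: AE_E)
  let ?Z = "(\<lambda>(x, y). (y, x)) -` Z"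
  have Z': "?Z \<in> sets borel"
    using measurable_sets[OF measurable_pair_swap'[of \<nu> \<nu>], of Z] Z(2)
    by (simp add: sets_borel_prod space_pair_measure)
  have "emeasure (mrw_prod m \<nu>) ?Z = emeasure (mrw_prod m \<nu>) Z"
    using emeasure_mrw_prod[OF Z'] emeasure_mrw_prod[OF Z(2)] reversible[OF Z(2)] by (simp add: indicator_def)
  then have "?Z \<in> null_sets (mrw_prod m \<nu>)" using Z Z' by auto
  then show ?thesis by (rule AE_I') (use Z(1) in auto)
qed

text \<open>
  Apply invariance to a Borel null set that covers the exceptional set.  This transfers Borel versions
  of \<open>\<nu>\<close>-measurable sets from \<open>\<nu>\<close> to the measures \<open>m\<^sub>x\<close>.
\<close>

lemma AE_walk:
  assumes "AE y in \<nu>. P y"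
  shows "AE x in \<nu>. AE y in m x. P y"
proof -
  obtain Z where Z: "{y. \<not> P y} \<subseteq> Z" "Z \<in> sets borel" "emeasure \<nu> Z = 0"
    using assms by (auto elim!: AE_E)
  have "(\<integral>\<^sup>+x. emeasure (m x) Z \<partial>\<nu>) = 0" using invariant Z by simp
  moreover have "(\<lambda>x. emeasure (m x) Z) \<in> borel_measurable \<nu>"
    using measurable_emeasure_kernel[OF subprob_kernel] Z by simp
  ultimately have "AE x in \<nu>. emeasure (m x) Z = 0" by (simp add: nn_integral_0_iff_AE)
  then show ?thesis
  proof eventually_elim
    case (elim x)
    then have "Z \<in> null_sets (m x)" using Z by auto
    then show ?case by (rule AE_I') (use Z(1) in auto)
  qed
qed

lemma mrw_L_AE_eq:
  assumes A: "AE x in \<nu>. x \<in> A' \<longleftrightarrow> x \<in> A"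
    and B: "B' \<in> sets borel" "AE x in \<nu>. x \<in> B' \<longleftrightarrow> x \<in> B"
  shows "mrw_L m \<nu> A B = (\<integral>\<^sup>+x\<in>A'. emeasure (m x) B' \<partial>\<nu>)"
  unfolding mrw_L_def nn_integral_completion
  using A AE_walk[OF B(2)]
  by (intro nn_integral_cong_AE, eventually_elim)
     (simp add: completion_AE_eq(2)[of B'] B(1) indicator_def)

end

section \<open>Restriction of the walk to a domain\<close>

locale random_walk_domain = metric_random_walk_space m \<nu>
  for m :: "'a::polish_space \<Rightarrow> 'a measure" and \<nu> +
  fixes \<Omega> :: "'a set"
  assumes \<Omega>_measurable: "\<Omega> \<in> sets (completion \<nu>)"
    and \<Omega>_pos: "0 < emeasure (completion \<nu>) \<Omega>"
    and \<Omega>_finite: "emeasure (completion \<nu>) \<Omega> < \<infinity>"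
begin

text \<open>
  The domain enters the flow problem through a Borel set \<open>W\<close> that differs from \<open>\<Omega>\<close> by a null set,
  and through the restrictions \<open>N\<close> of \<open>\<nu>\<close> and \<open>k\<close> of \<open>m\<close> to it.  Densities are used for the
  restrictions, so that all points of the type remain in the underlying space.
\<close>

definition W :: "'a set" where "W = main_part \<nu> \<Omega>"

definition N :: "'a measure" where "N = density \<nu> (indicator W)"

definition k :: "'a \<Rightarrow> 'a measure" where "k x = density (m x) (indicator W)"

lemma W_sets [measurable, simp]: "W \<in> sets borel"
  using main_part_sets[OF \<Omega>_measurable] by (simp add: W_def)

lemma W_subset: "W \<subseteq> \<Omega>"
  using main_part_null_part_Un[OF \<Omega>_measurable] by (auto simp: W_def)

lemma W_AE: "AE x in \<nu>. x \<in> W \<longleftrightarrow> x \<in> \<Omega>"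
  using AE_in_main_part[OF \<Omega>_measurable] by (simp add: W_def)

lemma emeasure_W: "0 < emeasure \<nu> W" "emeasure \<nu> W < \<infinity>"
  using \<Omega>_pos \<Omega>_finite \<Omega>_measurable by (simp_all add: W_def)

lemma sets_N [simp, measurable_cong]: "sets N = sets borel" by (simp add: N_def)
lemma space_N [simp]: "space N = UNIV" by (simp add: N_def)
lemma sets_k [simp, measurable_cong]: "sets (k x) = sets borel" by (simp add: k_def)
lemma space_k [simp]: "space (k x) = UNIV" by (simp add: k_def)

lemma emeasure_N: "A \<in> sets borel \<Longrightarrow> emeasure N A = emeasure \<nu> (W \<inter> A)"
  by (simp add: N_def emeasure_restricted)

lemma measure_k: "A \<in> sets borel \<Longrightarrow> measure (k x) A = measure (m x) (W \<inter> A)"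
  by (simp add: k_def measure_def emeasure_restricted)

lemma AE_N: "(AE x in N. P x) \<longleftrightarrow> (AE x in \<nu>. x \<in> \<Omega> \<longrightarrow> P x)"
proof -
  have "(AE x in N. P x) \<longleftrightarrow> (AE x in \<nu>. x \<in> W \<longrightarrow> P x)"
    unfolding N_def by (subst AE_density) (auto simp: indicator_def)
  also have "\<dots> \<longleftrightarrow> (AE x in \<nu>. x \<in> \<Omega> \<longrightarrow> P x)"
  proof (rule eventually_subst)
    show "AE x in \<nu>. (x \<in> W \<longrightarrow> P x) = (x \<in> \<Omega> \<longrightarrow> P x)"
      using W_AE by eventually_elim simp
  qed
  finally show ?thesis .
qed

lemma AE_N_W: "AE x in N. x \<in> W"
  unfolding AE_N using W_AE by eventually_elim simp

lemma subprob_kernel_k: "k \<in> N \<rightarrow>\<^sub>M subprob_algebra N"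
proof (rule measurable_subprob_algebra)
  fix x
  interpret prob_space "m x" by (rule prob_space_walk)
  show "subprob_space (k x)"
  proof
    show "emeasure (k x) (space (k x)) \<le> 1"
      using emeasure_le_1[of W] by (simp add: k_def emeasure_restricted)
  qed simp
  show "sets (k x) = sets N" by simp
next
  fix A assume "A \<in> sets N"
  then show "(\<lambda>x. emeasure (k x) A) \<in> borel_measurable N"
    using measurable_emeasure_kernel[OF subprob_kernel, of "W \<inter> A"]
    by (simp add: k_def emeasure_restricted cong: measurable_cong_sets)
qed

lemma sets_N_pair: "sets (N \<Otimes>\<^sub>M N) = sets (borel :: ('a \<times> 'a) measure)"
  by (simp add: sets_borel_prod)

lemma nn_integral_N_k:
  assumes F: "F \<in> borel_measurable (borel :: ('a \<times> 'a) measure)"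
  shows "(\<integral>\<^sup>+x. \<integral>\<^sup>+y. F (x, y) \<partial>k x \<partial>N) = (\<integral>\<^sup>+x. \<integral>\<^sup>+y. indicator (W \<times> W) (x, y) * F (x, y) \<partial>m x \<partial>\<nu>)"
proof -
  have F': "F \<in> borel_measurable (N \<Otimes>\<^sub>M N)" using F measurable_cong_sets[OF sets_N_pair refl] by blast
  have Fx: "(\<lambda>y. F (x, y)) \<in> borel_measurable (m x)" for x
    using measurable_compose[OF measurable_Pair1'[of x N N] F'] by (simp cong: measurable_cong_sets)
  have "(\<lambda>x. \<integral>\<^sup>+y. F (x, y) \<partial>k x) \<in> borel_measurable N"
    using F' by (intro nn_integral_measurable_subprob_algebra2[OF _ subprob_kernel_k]) (simp add: case_prod_unfold)
  then have "(\<integral>\<^sup>+x. \<integral>\<^sup>+y. F (x, y) \<partial>k x \<partial>N) = (\<integral>\<^sup>+x. indicator W x * (\<integral>\<^sup>+y. F (x, y) \<partial>k x) \<partial>\<nu>)"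
    unfolding N_def by (intro nn_integral_density) (auto cong: measurable_cong_sets)
  also have "\<dots> = (\<integral>\<^sup>+x. indicator W x * (\<integral>\<^sup>+y. indicator W y * F (x, y) \<partial>m x) \<partial>\<nu>)"
    unfolding k_def using Fx by (subst nn_integral_density) auto
  also have "\<dots> = (\<integral>\<^sup>+x. \<integral>\<^sup>+y. indicator (W \<times> W) (x, y) * F (x, y) \<partial>m x \<partial>\<nu>)"
    using Fx by (intro nn_integral_cong) (auto simp: indicator_def)
  finally show ?thesis .
qed

sublocale symmetric_kernel N k
proof (intro symmetric_kernel.intro symmetric_kernel_axioms.intro)
  show "finite_measure N" using emeasure_W by (intro finite_measureI) (simp add: emeasure_N)
  show "space N \<noteq> {}" by simp
  show "k \<in> N \<rightarrow>\<^sub>M subprob_algebra N" by (rule subprob_kernel_k)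
  fix C assume "C \<in> sets (N \<Otimes>\<^sub>M N)"
  then have C: "C \<in> sets borel" by (simp add: sets_borel_prod)
  let ?sC = "(\<lambda>(x, y). (y, x)) -` C"
  have sC: "?sC \<in> sets borel"
    using measurable_sets[OF measurable_pair_swap'[of \<nu> \<nu>], of C] C
    by (simp add: sets_borel_prod space_pair_measure)
  have WW: "W \<times> W \<in> sets borel"
    using pair_measureI[of W \<nu> W \<nu>] by (simp add: sets_borel_prod)
  have "(\<integral>\<^sup>+x. \<integral>\<^sup>+y. indicator C (x, y) \<partial>k x \<partial>N)
      = (\<integral>\<^sup>+x. \<integral>\<^sup>+y. indicator (W \<times> W) (x, y) * indicator C (x, y) \<partial>m x \<partial>\<nu>)"
    using C by (intro nn_integral_N_k) simp
  also have "\<dots> = (\<integral>\<^sup>+x. \<integral>\<^sup>+y. indicator ((W \<times> W) \<inter> C) (x, y) \<partial>m x \<partial>\<nu>)"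
    by (simp only: indicator_inter_arith)
  also have "\<dots> = (\<integral>\<^sup>+x. \<integral>\<^sup>+y. indicator ((W \<times> W) \<inter> C) (y, x) \<partial>m x \<partial>\<nu>)"
    using C WW by (intro reversible) simp
  also have "\<dots> = (\<integral>\<^sup>+x. \<integral>\<^sup>+y. indicator (W \<times> W) (x, y) * indicator ?sC (x, y) \<partial>m x \<partial>\<nu>)"
    by (intro nn_integral_cong) (auto simp: indicator_def)
  also have "\<dots> = (\<integral>\<^sup>+x. \<integral>\<^sup>+y. indicator ?sC (x, y) \<partial>k x \<partial>N)"
    using sC by (intro nn_integral_N_k[symmetric]) simp
  also have "\<dots> = (\<integral>\<^sup>+x. \<integral>\<^sup>+y. indicator C (y, x) \<partial>k x \<partial>N)"
    by (simp add: indicator_def)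
  finally show "(\<integral>\<^sup>+x. \<integral>\<^sup>+y. indicator C (x, y) \<partial>k x \<partial>N) = (\<integral>\<^sup>+x. \<integral>\<^sup>+y. indicator C (y, x) \<partial>k x \<partial>N)" .
qed

lemma borel_measurable_measure_walk:
  "A \<in> sets borel \<Longrightarrow> (\<lambda>x. measure (m x) A) \<in> borel_measurable N"
  "A \<in> sets borel \<Longrightarrow> (\<lambda>x. measure (k x) A) \<in> borel_measurable N"
  using measurable_emeasure_kernel[OF subprob_kernel, of A]
    measurable_emeasure_kernel[OF subprob_kernel_k, of A]
  unfolding measure_def by (auto cong: measurable_cong_sets intro!: borel_measurable_enn2real)

definition escape :: "'a \<Rightarrow> real" where "escape x = measure (m x) (UNIV - W)"

text \<open>
  For \<open>E \<subseteq> W\<close> this is the perimeter of \<open>E\<close>: \<^term>\<open>escape\<close> accounts for the jumps that leave \<open>\<Omega>\<close>,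
  and \<^term>\<open>k\<close> for those that leave \<open>E\<close> but stay in \<open>\<Omega>\<close>.
\<close>

definition flux :: "'a set \<Rightarrow> real" where
  "flux E = (\<integral>x. indicator E x * (escape x + measure (k x) (UNIV - E)) \<partial>N)"

lemma escape_eq: "escape x = 1 - measure (m x) W"
proof -
  interpret prob_space "m x" by (rule prob_space_walk)
  show ?thesis using prob_compl[of W] by (simp add: escape_def)
qed

lemma measurable_escape [measurable]: "escape \<in> borel_measurable N"
  unfolding escape_def by (rule borel_measurable_measure_walk) simp

lemma escape_bounds: "0 \<le> escape x" "escape x \<le> 1"
  by (simp_all add: escape_def prob_space.prob_le_1[OF prob_space_walk])

lemma measure_k_bounds: "0 \<le> measure (k x) A" "measure (k x) A \<le> 1"
  using subprob_space.subprob_measure_le_1[OF subprob_space_kernel[OF subprob_kernel_k, of x], of A]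
  by simp_all

lemma integrable_flux_parts:
  assumes [measurable]: "E \<in> sets borel"
  shows "integrable N (\<lambda>x. indicator E x * escape x)"
    "integrable N (\<lambda>x. indicator E x * measure (k x) (UNIV - E))"
proof -
  have [measurable]: "(\<lambda>x. measure (k x) (UNIV - E)) \<in> borel_measurable N"
    by (rule borel_measurable_measure_walk) simp
  show "integrable N (\<lambda>x. indicator E x * escape x)"
    by (rule integrable_const_bound[where B=1]) (auto simp: indicator_def escape_bounds)
  show "integrable N (\<lambda>x. indicator E x * measure (k x) (UNIV - E))"
    by (rule integrable_const_bound[where B=1]) (auto simp: indicator_def measure_k_bounds)
qed

lemma flux_split:
  assumes "E \<in> sets borel"
  shows "flux E = (\<integral>x. indicator E x * escape x \<partial>N) + (\<integral>x. indicator E x * measure (k x) (UNIV - E) \<partial>N)"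
  unfolding flux_def distrib_left using integrable_flux_parts[OF assms] by simp

lemma flux_Int_W:
  assumes E: "E \<in> sets borel"
  shows "flux (E \<inter> W) = flux E"
proof -
  have "W \<inter> (UNIV - E \<inter> W) = W \<inter> (UNIV - E)" by auto
  then have "measure (k x) (UNIV - E \<inter> W) = measure (k x) (UNIV - E)" for x
    using E by (simp add: measure_k)
  then show ?thesis
    unfolding flux_def
    using AE_N_W E borel_measurable_measure_walk[of "UNIV - E"]
    by (intro integral_cong_AE) (auto simp: indicator_def)
qed

lemma measure_N_Int_W: "E \<in> sets borel \<Longrightarrow> measure N (E \<inter> W) = measure N E"
  by (simp add: measure_def emeasure_N Int_commute Int_left_commute)

lemma perimeter_eq_flux:
  assumes E: "E \<in> sets borel" "E \<subseteq> W" and ae: "AE x in \<nu>. x \<in> E \<longleftrightarrow> x \<in> A"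
  shows "mrw_perimeter m \<nu> A = ennreal (flux E)"
    and "A \<in> sets (completion \<nu>)"
    and "emeasure (completion \<nu>) A = ennreal (measure N E)"
proof -
  note [measurable] = E(1)
  have [measurable]: "(\<lambda>x. measure (k x) (UNIV - E)) \<in> borel_measurable N"
    by (rule borel_measurable_measure_walk) simp
  have meas: "(\<lambda>x. indicator E x * (escape x + measure (k x) (UNIV - E))) \<in> borel_measurable N"
    by measurable
  have "AE x in \<nu>. x \<in> UNIV - E \<longleftrightarrow> x \<in> UNIV - A" using ae by eventually_elim simp
  then have "mrw_perimeter m \<nu> A = (\<integral>\<^sup>+x\<in>E. emeasure (m x) (UNIV - E) \<partial>\<nu>)"
    unfolding mrw_perimeter_def using ae by (intro mrw_L_AE_eq) auto
  also have "\<dots> = (\<integral>\<^sup>+x. indicator W x * ennreal (indicator E x * (escape x + measure (k x) (UNIV - E))) \<partial>\<nu>)"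
  proof (intro nn_integral_cong)
    fix x
    interpret prob_space "m x" by (rule prob_space_walk)
    have "(UNIV - W) \<union> W \<inter> (UNIV - E) = UNIV - E" using E(2) by auto
    then have "measure (m x) (UNIV - E) = escape x + measure (k x) (UNIV - E)"
      using finite_measure_Union[of "UNIV - W" "W \<inter> (UNIV - E)"] by (auto simp: escape_def measure_k)
    then show "emeasure (m x) (UNIV - E) * indicator E x
        = indicator W x * ennreal (indicator E x * (escape x + measure (k x) (UNIV - E)))"
      using E(2) by (auto simp: indicator_def emeasure_eq_measure)
  qed
  also have "\<dots> = (\<integral>\<^sup>+x. ennreal (indicator E x * (escape x + measure (k x) (UNIV - E))) \<partial>N)"
    using meas unfolding N_def
    by (intro nn_integral_density[symmetric]) (auto cong: measurable_cong_sets)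
  also have "\<dots> = ennreal (flux E)"
    unfolding flux_def
  proof (rule nn_integral_eq_integral)
    show "integrable N (\<lambda>x. indicator E x * (escape x + measure (k x) (UNIV - E)))"
      unfolding distrib_left using integrable_flux_parts[OF E(1)] by simp
  qed (auto intro!: AE_I2 mult_nonneg_nonneg add_nonneg_nonneg simp: escape_bounds)
  finally show "mrw_perimeter m \<nu> A = ennreal (flux E)" .
  show "A \<in> sets (completion \<nu>)"
    using E ae by (intro completion_AE_eq) auto
  have "emeasure (completion \<nu>) A = emeasure \<nu> E"
    using E ae by (intro completion_AE_eq) auto
  also have "\<dots> = emeasure N E" using E by (simp add: emeasure_N Int_absorb1)
  finally show "emeasure (completion \<nu>) A = ennreal (measure N E)"
    by (simp add: emeasure_eq_measure)
qed

definition ratio :: real where "ratio = enn2real (mrw_ratio m \<nu> \<Omega>)"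

lemma measure_N_W: "measure N W > 0"
  using emeasure_W by (simp add: measure_def emeasure_N enn2real_positive_iff)

lemma flux_nonneg: "0 \<le> flux E"
  unfolding flux_def
  by (intro integral_nonneg_AE AE_I2 mult_nonneg_nonneg add_nonneg_nonneg) (simp_all add: escape_bounds)

lemma mrw_ratio_eq:
  assumes E: "E \<in> sets borel" "E \<subseteq> W" "AE x in \<nu>. x \<in> E \<longleftrightarrow> x \<in> A" and pos: "measure N E > 0"
  shows "mrw_ratio m \<nu> A = ennreal (flux E / measure N E)"
  unfolding mrw_ratio_def perimeter_eq_flux[OF E] using pos flux_nonneg by (simp add: divide_ennreal)

lemma ratio_eq: "ratio = flux W / measure N W" "mrw_ratio m \<nu> \<Omega> = ennreal ratio"
proof -
  have *: "mrw_ratio m \<nu> \<Omega> = ennreal (flux W / measure N W)"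
    using W_AE measure_N_W by (intro mrw_ratio_eq) auto
  then show "ratio = flux W / measure N W" using flux_nonneg by (simp add: ratio_def)
  then show "mrw_ratio m \<nu> \<Omega> = ennreal ratio" using * by simp
qed

text \<open>
  \<open>\<Omega>\<close> is itself a competitor in the infimum that defines the Cheeger constant, so calibrability
  says that no competitor has a smaller ratio; the null sets on the right-hand side satisfy
  their inequality trivially.
\<close>

lemma calibrable_iff_flux:
  "mrw_calibrable m \<nu> \<Omega> \<longleftrightarrow> (\<forall>E\<in>sets borel. ratio * measure N E \<le> flux E)"
proof -
  let ?S = "{E \<in> sets (completion \<nu>). E \<subseteq> \<Omega> \<and> emeasure (completion \<nu>) E > 0}"
  have "\<Omega> \<in> ?S" using \<Omega>_measurable \<Omega>_pos by auto
  then have "mrw_cheeger m \<nu> \<Omega> \<le> mrw_ratio m \<nu> \<Omega>"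
    unfolding mrw_cheeger_def by (rule INF_lower)
  then have "mrw_calibrable m \<nu> \<Omega> \<longleftrightarrow> mrw_ratio m \<nu> \<Omega> \<le> mrw_cheeger m \<nu> \<Omega>"
    unfolding mrw_calibrable_def by (metis antisym order_refl)
  also have "\<dots> \<longleftrightarrow> (\<forall>A\<in>?S. ennreal ratio \<le> mrw_ratio m \<nu> A)"
    unfolding mrw_cheeger_def ratio_eq(2) by (rule le_INF_iff)
  also have "\<dots> \<longleftrightarrow> (\<forall>E\<in>sets borel. ratio * measure N E \<le> flux E)"
  proof (intro iffI ballI)
    fix E :: "'a set" assume *: "\<forall>A\<in>?S. ennreal ratio \<le> mrw_ratio m \<nu> A" and E: "E \<in> sets borel"
    let ?E = "E \<inter> W"
    have E': "?E \<in> sets borel" "?E \<subseteq> W" "AE x in \<nu>. x \<in> ?E \<longleftrightarrow> x \<in> ?E" using E by auto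
    show "ratio * measure N E \<le> flux E"
    proof (cases "measure N ?E > 0")
      case True
      then have "?E \<in> ?S" using perimeter_eq_flux[OF E'] W_subset by (auto simp: ennreal_less_zero_iff)
      then have "ennreal ratio \<le> ennreal (flux ?E / measure N ?E)"
        using * mrw_ratio_eq[OF E' True] by auto
      then have "ratio \<le> flux ?E / measure N ?E"
        using flux_nonneg[of ?E] True by (simp add: ennreal_le_iff)
      then show ?thesis using True flux_Int_W[OF E] measure_N_Int_W[OF E] by (simp add: field_simps)
    next
      case False
      then have "measure N E = 0" using measure_N_Int_W[OF E] by (simp add: zero_less_measure_iff)
      then show ?thesis using flux_nonneg by simp
    qed
  next
    fix A assume *: "\<forall>E\<in>sets borel. ratio * measure N E \<le> flux E" and A: "A \<in> ?S"
    let ?E = "main_part \<nu> A \<inter> W"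
    have "AE x in \<nu>. x \<in> main_part \<nu> A \<longleftrightarrow> x \<in> A" using A by (intro AE_in_main_part) auto
    then have "AE x in \<nu>. x \<in> ?E \<longleftrightarrow> x \<in> A"
      using W_AE by eventually_elim (use A in auto)
    moreover have "main_part \<nu> A \<in> sets borel" using main_part_sets[of A \<nu>] A by simp
    ultimately have E: "?E \<in> sets borel" "?E \<subseteq> W" "AE x in \<nu>. x \<in> ?E \<longleftrightarrow> x \<in> A" by auto
    have pos: "measure N ?E > 0"
      using A perimeter_eq_flux(3)[OF E] by (simp add: ennreal_less_zero_iff)
    have "ratio \<le> flux ?E / measure N ?E" using * E(1) pos by (simp add: field_simps)
    then show "ennreal ratio \<le> mrw_ratio m \<nu> A"
      unfolding mrw_ratio_eq[OF E pos] by (rule ennreal_leI)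
  qed
  finally show ?thesis .
qed

text \<open>
  Subtracting the escape term from both sides turns \<open>ratio * \<nu>(E) \<le> P(E)\<close> into the cut condition for
  \<open>escape - ratio\<close>, whose integral over the domain vanishes because the inequality is an equality
  for \<open>E = W\<close>.
\<close>

lemma calibrable_iff_flow:
  "mrw_calibrable m \<nu> \<Omega> \<longleftrightarrow> (\<exists>g\<in>flows. AE x in N. escape x - ratio = outflow g x)"
proof -
  let ?f = "\<lambda>x. escape x - ratio"
  have f: "?f \<in> borel_measurable N" by measurable
  have cut_iff: "- (\<integral>x. indicator E x * ?f x \<partial>N) \<le> (\<integral>x. indicator E x * measure (k x) (space N - E) \<partial>N)
      \<longleftrightarrow> ratio * measure N E \<le> flux E" if E: "E \<in> sets borel" for E
  proof -
    have "(\<integral>x. indicator E x * ?f x \<partial>N) = (\<integral>x. indicator E x * escape x \<partial>N) - ratio * measure N E"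
    proof -
      have "integrable N (indicator E :: 'a \<Rightarrow> real)"
        using E by (intro integrable_const_bound[where B=1]) auto
      then show ?thesis
        unfolding right_diff_distrib using E integrable_flux_parts(1)[OF E]
        by (subst Bochner_Integration.integral_diff) auto
    qed
    then show ?thesis unfolding flux_split[OF E] by auto
  qed
  show ?thesis
  proof
    assume "mrw_calibrable m \<nu> \<Omega>"
    then have le: "\<And>E. E \<in> sets borel \<Longrightarrow> ratio * measure N E \<le> flux E"
      using calibrable_iff_flux by blast
    have "flux UNIV = (\<integral>x. escape x \<partial>N)" by (simp add: flux_def)
    moreover have "flux UNIV = flux W" "measure N UNIV = measure N W"
      using flux_Int_W[of UNIV] measure_N_Int_W[of UNIV] by simp_all
    moreover have "flux W = ratio * measure N W" using ratio_eq(1) measure_N_W by simp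
    moreover have "integrable N escape" using integrable_flux_parts(1)[of UNIV] by simp
    ultimately have "(\<integral>x. ?f x \<partial>N) = 0" by (simp add: mult.commute)
    moreover have "\<bar>?f x\<bar> \<le> 1 + \<bar>ratio\<bar>" for x using escape_bounds[of x] by linarith
    ultimately show "\<exists>g\<in>flows. AE x in N. ?f x = outflow g x"
      using cut_iff le by (intro cut_condition_imp_flow[OF f]) auto
  next
    assume "\<exists>g\<in>flows. AE x in N. ?f x = outflow g x"
    then obtain g where g: "g \<in> flows" and ae: "AE x in N. ?f x = outflow g x" by blast
    have "ratio * measure N E \<le> flux E" if E: "E \<in> sets borel" for E
    proof -
      have "(\<integral>x. indicator E x * ?f x \<partial>N) = (\<integral>x. indicator E x * outflow g x \<partial>N)"
        using ae measurable_outflow[OF g] E by (intro integral_cong_AE) auto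
      then show ?thesis
        using flow_imp_cut_condition[OF g, of E] E cut_iff[OF E] by simp
    qed
    then show "mrw_calibrable m \<nu> \<Omega>" using calibrable_iff_flux by blast
  qed
qed

text \<open>
  Almost every section of \<open>g\<close> agrees with the Borel function \<open>F\<close> almost everywhere, which
  identifies the integrals with respect to the completions of the \<open>m\<^sub>x\<close>.
\<close>

lemma divergence_condition_iff:
  assumes F: "F \<in> borel_measurable borel"
    and ae: "AE (x, y) in mrw_prod m \<nu>. x \<in> W \<longrightarrow> y \<in> W \<longrightarrow> F (x, y) = g x y"
  shows "(AE x in \<nu>. x \<in> \<Omega> \<longrightarrow>
            ratio = - (LINT y:\<Omega>|completion (m x). g x y) + 1 - measure (completion (m x)) \<Omega>)
     \<longleftrightarrow> (AE x in N. escape x - ratio = outflow F x)"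
proof -
  have F': "F \<in> borel_measurable (\<nu> \<Otimes>\<^sub>M \<nu>)"
    using F measurable_cong_sets[OF sets_pair_invariant refl] by blast
  have Fx: "(\<lambda>y. F (x, y)) \<in> borel_measurable (m x)" for x
    using measurable_compose[OF measurable_Pair1'[of x \<nu> \<nu>] F'] by (simp cong: measurable_cong_sets)
  have k_int: "outflow F x = (\<integral>y. indicator W y * F (x, y) \<partial>m x)" for x
    unfolding k_def ennreal_indicator[symmetric] using Fx by (subst integral_density) auto
  have "AE x in \<nu>. AE y in m x. x \<in> W \<longrightarrow> y \<in> W \<longrightarrow> F (x, y) = g x y"
    using AE_mrw_prodD[OF ae] by simp
  then have "AE x in \<nu>. x \<in> \<Omega> \<longrightarrow>
      (ratio = - (LINT y:\<Omega>|completion (m x). g x y) + 1 - measure (completion (m x)) \<Omega>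
       \<longleftrightarrow> escape x - ratio = outflow F x)"
    using W_AE AE_walk[OF W_AE]
  proof eventually_elim
    case (elim x)
    show ?case
    proof
      assume "x \<in> \<Omega>"
      then have x: "x \<in> W" using elim by simp
      have "measure (completion (m x)) \<Omega> = measure (m x) W"
        using completion_AE_eq[of W "m x" \<Omega>] elim(3) by (simp add: measure_def)
      moreover have "(LINT y:\<Omega>|completion (m x). g x y) = outflow F x"
        unfolding set_lebesgue_integral_def k_int
      proof (rule integral_completion_AE_eq)
        show "(\<lambda>y. indicator W y * F (x, y)) \<in> borel_measurable (m x)" using Fx by measurable
        show "AE y in m x. indicator W y * F (x, y) = indicator \<Omega> y *\<^sub>R g x y"
          using elim(1,3) by eventually_elim (use x in \<open>auto simp: indicator_def\<close>)
      qed
      ultimately show "ratio = - (LINT y:\<Omega>|completion (m x). g x y) + 1 - measure (completion (m x)) \<Omega>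
          \<longleftrightarrow> escape x - ratio = outflow F x"
        by (auto simp: escape_eq)
    qed
  qed
  then show ?thesis
    unfolding AE_N by (intro eventually_subst) (auto elim: eventually_mono)
qed

text \<open>
  Antisymmetrising and truncating a Borel version of \<open>g\<close> on \<open>W \<times> W\<close> makes the conditions hold
  everywhere.  This changes it only on a null set, because the edge measure is invariant under
  exchanging the two points.
\<close>

lemma Borel_representative_of_flow:
  assumes g: "(\<lambda>(x, y). g x y) \<in> borel_measurable (restrict_space (completion (mrw_prod m \<nu>)) (\<Omega> \<times> \<Omega>))"
    and anti: "AE (x, y) in mrw_prod m \<nu>. (x, y) \<in> \<Omega> \<times> \<Omega> \<longrightarrow> g x y = - g y x"
    and bound: "AE (x, y) in mrw_prod m \<nu>. (x, y) \<in> \<Omega> \<times> \<Omega> \<longrightarrow> - 1 \<le> g x y \<and> g x y \<le> 1"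
  shows "\<exists>F\<in>flows. AE (x, y) in mrw_prod m \<nu>. x \<in> W \<longrightarrow> y \<in> W \<longrightarrow> F (x, y) = g x y"
proof -
  let ?M = "completion (mrw_prod m \<nu>)"
  let ?g = "\<lambda>z. indicator (W \<times> W) z * (case z of (x, y) \<Rightarrow> g x y)"
  have WW: "W \<times> W \<in> sets borel"
    using pair_measureI[of W \<nu> W \<nu>] by (simp add: sets_borel_prod)
  have "(\<lambda>(x, y). g x y) \<in> borel_measurable (restrict_space ?M (W \<times> W))"
    using W_subset by (intro measurable_restrict_mono[OF g]) auto
  then have "?g \<in> borel_measurable ?M"
    using WW by (subst (asm) borel_measurable_restrict_space_iff) (auto simp: mult.commute)
  then obtain G where G: "G \<in> borel_measurable borel" and G_ae: "AE z in mrw_prod m \<nu>. ?g z = G z"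
    using completion_ex_borel_measurable_real[of ?g "mrw_prod m \<nu>"]
    by (auto cong: measurable_cong_sets)
  define F where "F z = max (- 1) (min 1 ((G z - G (snd z, fst z)) / 2))" for z
  have "F \<in> flows"
    unfolding flows_def
  proof (intro CollectI conjI allI)
    have [measurable]: "G \<in> borel_measurable (N \<Otimes>\<^sub>M N)"
      using G measurable_cong_sets[OF sets_N_pair refl] by blast
    show "F \<in> borel_measurable (N \<Otimes>\<^sub>M N)"
      unfolding F_def by measurable
    have clamp: "max (- 1) (min 1 (- a)) = - max (- 1) (min 1 a)" for a :: real
      by (simp add: max_def min_def)
    show "F (x, y) = - F (y, x)" for x y
      using clamp[of "(G (y, x) - G (x, y)) / 2"] by (simp add: F_def minus_divide_left)
    show "\<bar>F z\<bar> \<le> 1" for z by (simp add: F_def abs_le_iff)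
  qed
  moreover have "AE (x, y) in mrw_prod m \<nu>. x \<in> W \<longrightarrow> y \<in> W \<longrightarrow> F (x, y) = g x y"
    using G_ae AE_mrw_prod_swap[OF G_ae] anti bound
  proof eventually_elim
    case (elim z)
    obtain x y where z: "z = (x, y)" by (cases z)
    show ?case
      unfolding z prod.case
    proof (intro impI)
      assume xy: "x \<in> W" "y \<in> W"
      then have "G (x, y) = g x y" "G (y, x) = g y x" "g x y = - g y x" "- 1 \<le> g x y" "g x y \<le> 1"
        using elim W_subset unfolding z by auto
      then show "F (x, y) = g x y" by (simp add: F_def)
    qed
  qed
  ultimately show ?thesis by blast
qed

end

section \<open>Calibrable sets\<close>

theorem theorem5p8:
  fixes m :: "'a::polish_space \<Rightarrow> 'a measure" and \<nu> :: "'a measure" and \<Omega> :: "'a set"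
  assumes "metric_random_walk_space m \<nu>"
    and "\<Omega> \<in> sets (completion \<nu>)"
    and "0 < emeasure (completion \<nu>) \<Omega>"
    and "emeasure (completion \<nu>) \<Omega> < emeasure (completion \<nu>) UNIV"
  shows "mrw_calibrable m \<nu> \<Omega> \<longleftrightarrow>
    (\<exists>g :: 'a \<Rightarrow> 'a \<Rightarrow> real.
       (\<lambda>(x, y). g x y) \<in> borel_measurable (restrict_space (completion (mrw_prod m \<nu>)) (\<Omega> \<times> \<Omega>)) \<and>
       (AE (x, y) in mrw_prod m \<nu>. (x, y) \<in> \<Omega> \<times> \<Omega> \<longrightarrow> g x y = - g y x) \<and>
       (AE (x, y) in mrw_prod m \<nu>. (x, y) \<in> \<Omega> \<times> \<Omega> \<longrightarrow> - 1 \<le> g x y \<and> g x y \<le> 1) \<and>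
       (AE x in \<nu>. x \<in> \<Omega> \<longrightarrow>
          enn2real (mrw_ratio m \<nu> \<Omega>) =
            - (LINT y:\<Omega>|completion (m x). g x y) + 1 - measure (completion (m x)) \<Omega>))"
proof -
  interpret metric_random_walk_space m \<nu> by fact
  interpret random_walk_domain m \<nu> \<Omega>
  proof unfold_locales
    show "emeasure (completion \<nu>) \<Omega> < \<infinity>"
      unfolding infinity_ennreal_def using assms(4) by (rule order.strict_trans2) (rule top_greatest)
  qed fact+
  show ?thesis
    unfolding calibrable_iff_flow ratio_def[symmetric]
  proof (intro iffI; elim bexE exE conjE)
    fix F assume F: "F \<in> flows" and ae: "AE x in N. escape x - ratio = outflow F x"
    have F_borel: "F \<in> borel_measurable borel"
      using flowsD(1)[OF F] measurable_cong_sets[OF sets_N_pair refl] by blast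
    then have "F \<in> borel_measurable (completion (mrw_prod m \<nu>))"
      by (intro measurable_completion) (simp cong: measurable_cong_sets)
    then have "(\<lambda>(x, y). F (x, y)) \<in> borel_measurable (restrict_space (completion (mrw_prod m \<nu>)) (\<Omega> \<times> \<Omega>))"
      by (simp add: measurable_restrict_space1)
    moreover have "AE (x, y) in mrw_prod m \<nu>. (x, y) \<in> \<Omega> \<times> \<Omega> \<longrightarrow> F (x, y) = - F (y, x)"
      using flowsD(2)[OF F] by (intro AE_I2) blast
    moreover have "AE (x, y) in mrw_prod m \<nu>. (x, y) \<in> \<Omega> \<times> \<Omega> \<longrightarrow> - 1 \<le> F (x, y) \<and> F (x, y) \<le> 1"
      using flowsD(3)[OF F] by (intro AE_I2) (auto simp: abs_le_iff minus_le_iff)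
    moreover have "AE x in \<nu>. x \<in> \<Omega> \<longrightarrow>
        ratio = - (LINT y:\<Omega>|completion (m x). F (x, y)) + 1 - measure (completion (m x)) \<Omega>"
      using divergence_condition_iff[OF F_borel, of "\<lambda>x y. F (x, y)"] ae by simp
    ultimately show "\<exists>g.
       (\<lambda>(x, y). g x y) \<in> borel_measurable (restrict_space (completion (mrw_prod m \<nu>)) (\<Omega> \<times> \<Omega>)) \<and>
       (AE (x, y) in mrw_prod m \<nu>. (x, y) \<in> \<Omega> \<times> \<Omega> \<longrightarrow> g x y = - g y x) \<and>
       (AE (x, y) in mrw_prod m \<nu>. (x, y) \<in> \<Omega> \<times> \<Omega> \<longrightarrow> - 1 \<le> g x y \<and> g x y \<le> 1) \<and>
       (AE x in \<nu>. x \<in> \<Omega> \<longrightarrow>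
          ratio = - (LINT y:\<Omega>|completion (m x). g x y) + 1 - measure (completion (m x)) \<Omega>)"
      by (intro exI[of _ "\<lambda>x y. F (x, y)"] conjI)
  next
    fix g :: "'a \<Rightarrow> 'a \<Rightarrow> real"
    assume g: "(\<lambda>(x, y). g x y) \<in> borel_measurable (restrict_space (completion (mrw_prod m \<nu>)) (\<Omega> \<times> \<Omega>))"
      "AE (x, y) in mrw_prod m \<nu>. (x, y) \<in> \<Omega> \<times> \<Omega> \<longrightarrow> g x y = - g y x"
      "AE (x, y) in mrw_prod m \<nu>. (x, y) \<in> \<Omega> \<times> \<Omega> \<longrightarrow> - 1 \<le> g x y \<and> g x y \<le> 1"
      and div: "AE x in \<nu>. x \<in> \<Omega> \<longrightarrow>
          ratio = - (LINT y:\<Omega>|completion (m x). g x y) + 1 - measure (completion (m x)) \<Omega>"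
    obtain F where F: "F \<in> flows"
      and F_g: "AE (x, y) in mrw_prod m \<nu>. x \<in> W \<longrightarrow> y \<in> W \<longrightarrow> F (x, y) = g x y"
      using Borel_representative_of_flow[OF g] by blast
    have "F \<in> borel_measurable borel"
      using flowsD(1)[OF F] measurable_cong_sets[OF sets_N_pair refl] by blast
    then have "AE x in N. escape x - ratio = outflow F x"
      using divergence_condition_iff[OF _ F_g] div by blast
    then show "\<exists>g\<in>flows. AE x in N. escape x - ratio = outflow g x" using F by blast
  qed
qed

end
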